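(* Let $D$ be a Newton diagram in $3$ variables whose support $K\subset\mathbb N_0^3$ has size $d$ and satisfies the no-overhang condition. Then $\#(D)\ge 2d+2$.
   Context: For $m\in\mathbb Z^n$ write $|m|=m_1+\dots+m_n$; $e_1,\dots,e_n$ is the standard basis. A Newton diagram in $n$ variables is a function $D\colon\mathbb Z^n\to\{0,P,N\}$ ($P,N$ formal symbols) whose support $K=D^{-1}(\{P,N\})$ is a finite nonempty subset of $\mathbb N_0^n$. For $a\in\mathbb Z^n$ let $E(a)=\{a,a-e_1,\dots,a-e_n\}$; $E(a)$ is a node of $D$ if the image $D(E(a))$ equals $\{P\}$, $\{N\}$, $\{0,P\}$ or $\{0,N\}$. $\#(D)$ is the number of $a\in\mathbb Z^n$ for which $E(a)$ is a node. The size of $K$ is $k-|a|+1$ where $k=\max_{m\in K}|m|$ and $a_j=\min_{m\in K}m_j$. Overhangs: for $K\subset\mathbb Z^2$, a point $(a,b)\in K$ with $(a,b)\ne(0,0)$ is a left overhang if $(a,b-1)\notin K$ and $(a-1,y)\notin K$ for all $y\ge b$; it is a right overhang if $(a-1,b)\notin K$ and $(x,b-1)\notin K$ for all $x\ge a$; an overhang is a left or right overhang. For $K\subset\mathbb Z^3$ define $\pi_1(m)=(m_1,m_2+m_3)$, $\pi_2(m)=(m_1+m_3,m_2)$, $\pi_3(m)=(m_1+m_2,m_3)$; $m\in K$ is an overhang if $\pi_j(m)$ is an overhang of $\pi_j(K)$ for some $j$. $K$ satisfies the no-overhang condition if it has no overhang. *)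

theory Defs
  imports Main
begin

datatype sgn = Zero | Pos | Neg

type_synonym pt3 = "int \<times> int \<times> int"

definition support3 :: "(pt3 \<Rightarrow> sgn) \<Rightarrow> pt3 set" where
  "support3 D = {m. D m \<in> {Pos, Neg}}"

definition newton_diagram3 :: "(pt3 \<Rightarrow> sgn) \<Rightarrow> bool" where
  "newton_diagram3 D \<longleftrightarrow> finite (support3 D) \<and> support3 D \<noteq> {} \<and>
     (\<forall>x y z. (x, y, z) \<in> support3 D \<longrightarrow> x \<ge> 0 \<and> y \<ge> 0 \<and> z \<ge> 0)"

definition E3 :: "pt3 \<Rightarrow> pt3 set" where
  "E3 a = (case a of (x, y, z) \<Rightarrow> {(x, y, z), (x - 1, y, z), (x, y - 1, z), (x, y, z - 1)})"

definition is_node3 :: "(pt3 \<Rightarrow> sgn) \<Rightarrow> pt3 \<Rightarrow> bool" where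
  "is_node3 D a \<longleftrightarrow> D ` E3 a \<in> {{Pos}, {Neg}, {Zero, Pos}, {Zero, Neg}}"

definition num_nodes3 :: "(pt3 \<Rightarrow> sgn) \<Rightarrow> nat" where
  "num_nodes3 D = card {a. is_node3 D a}"

definition size3 :: "pt3 set \<Rightarrow> int" where
  "size3 K = Max ((\<lambda>(x, y, z). x + y + z) ` K)
     - (Min ((\<lambda>(x, y, z). x) ` K) + Min ((\<lambda>(x, y, z). y) ` K) + Min ((\<lambda>(x, y, z). z) ` K)) + 1"

definition left_overhang :: "(int \<times> int) set \<Rightarrow> int \<times> int \<Rightarrow> bool" where
  "left_overhang K p \<longleftrightarrow> (case p of (a, b) \<Rightarrow>
     (a, b) \<in> K \<and> (a, b) \<noteq> (0, 0) \<and> (a, b - 1) \<notin> K \<and> (\<forall>y\<ge>b. (a - 1, y) \<notin> K))"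

definition right_overhang :: "(int \<times> int) set \<Rightarrow> int \<times> int \<Rightarrow> bool" where
  "right_overhang K p \<longleftrightarrow> (case p of (a, b) \<Rightarrow>
     (a, b) \<in> K \<and> (a, b) \<noteq> (0, 0) \<and> (a - 1, b) \<notin> K \<and> (\<forall>x\<ge>a. (x, b - 1) \<notin> K))"

definition overhang2 :: "(int \<times> int) set \<Rightarrow> int \<times> int \<Rightarrow> bool" where
  "overhang2 K p \<longleftrightarrow> left_overhang K p \<or> right_overhang K p"

definition proj1 :: "pt3 \<Rightarrow> int \<times> int" where
  "proj1 m = (case m of (x, y, z) \<Rightarrow> (x, y + z))"
definition proj2 :: "pt3 \<Rightarrow> int \<times> int" where
  "proj2 m = (case m of (x, y, z) \<Rightarrow> (x + z, y))"
definition proj3 :: "pt3 \<Rightarrow> int \<times> int" where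
  "proj3 m = (case m of (x, y, z) \<Rightarrow> (x + y, z))"

definition overhang3 :: "pt3 set \<Rightarrow> pt3 \<Rightarrow> bool" where
  "overhang3 K m \<longleftrightarrow> m \<in> K \<and>
     (overhang2 (proj1 ` K) (proj1 m) \<or> overhang2 (proj2 ` K) (proj2 m) \<or> overhang2 (proj3 ` K) (proj3 m))"

definition no_overhang3 :: "pt3 set \<Rightarrow> bool" where
  "no_overhang3 K \<longleftrightarrow> (\<forall>m\<in>K. \<not> overhang3 K m)"

end

theory Submission
  imports Defs
begin

text \<open>
  The no-overhang condition for \<open>proj1\<close> already forces every layer \<open>x + y + z = c\<close> with
  \<open>0 \<le> c \<le> k\<close> of the support to be nonempty, so that the size is \<open>k + 1\<close>. A layer is a finite set
  of points of the triangular lattice, and the nodes on level \<open>c + 1\<close> depend only on the layers \<open>c + 1\<close>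
  and \<open>c\<close>. We descend from the top layer, carrying a signed set \<open>V\<close> that contains the current
  layer and a potential \<open>Phi V\<close>. Twice the number of nodes above the top layer is at least the potential of
  that layer. Filling the holes of \<open>V\<close> gives a hole-free \<open>F\<close> and does not increase the potential; the next set
  consists of the next layer together with the erosion of \<open>F\<close>, its added points carrying the sign
  opposite to the one of the previous added points. By a charging argument and an Euler-type inequality for
  hole-free sets, each descent accounts for \<open>Phi W - Phi F + 4\<close> half nodes. Hole-free nonempty sets
  have potential at least 6, and the origin is one more node, so that twice the number of nodes is at least
  \<open>2 + 4 * k + 6\<close>.
\<close>

section \<open>Finitely supported sums over the lattice plane\<close>

definition fin_supp :: "(int \<Rightarrow> int \<Rightarrow> int) \<Rightarrow> bool" where
  "fin_supp f \<longleftrightarrow> finite {(x, y). f x y \<noteq> 0}"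

text \<open>For an infinite support the sum takes the default value 0, so additivity and
  monotonicity are stated under \<open>fin_supp\<close>.\<close>

definition plane_sum :: "(int \<Rightarrow> int \<Rightarrow> int) \<Rightarrow> int" where
  "plane_sum f = (\<Sum>(x, y)\<in>{(x, y). f x y \<noteq> 0}. f x y)"

lemma plane_sum_eq:
  assumes "finite X" "\<And>x y. (x, y) \<notin> X \<Longrightarrow> f x y = 0"
  shows "plane_sum f = (\<Sum>(x, y)\<in>X. f x y)"
  unfolding plane_sum_def using assms by (intro sum.mono_neutral_left) auto

lemma fin_supp_dominated: "fin_supp f \<Longrightarrow> (\<And>x y. f x y = 0 \<Longrightarrow> h x y = 0) \<Longrightarrow> fin_supp h"
  unfolding fin_supp_def by (rule finite_subset[rotated], assumption) auto

lemma fin_supp_add: "fin_supp f \<Longrightarrow> fin_supp h \<Longrightarrow> fin_supp (\<lambda>x y. f x y + h x y)"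
  unfolding fin_supp_def
  by (rule finite_subset[of _ "{(x, y). f x y \<noteq> 0} \<union> {(x, y). h x y \<noteq> 0}"]) auto

lemma fin_supp_cmul: "fin_supp f \<Longrightarrow> fin_supp (\<lambda>x y. c * f x y)"
  by (erule fin_supp_dominated) simp

lemma fin_supp_shift:
  assumes "fin_supp f"
  shows "fin_supp (\<lambda>x y. f (x + a) (y + b))"
proof -
  have "{(x, y). f (x + a) (y + b) \<noteq> 0} \<subseteq> (\<lambda>(x, y). (x - a, y - b)) ` {(x, y). f x y \<noteq> 0}"
  proof
    fix p assume "p \<in> {(x, y). f (x + a) (y + b) \<noteq> 0}"
    then show "p \<in> (\<lambda>(x, y). (x - a, y - b)) ` {(x, y). f x y \<noteq> 0}"
      by (intro image_eqI[of _ _ "(fst p + a, snd p + b)"]) (auto split: prod.splits)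
  qed
  then show ?thesis
    using assms unfolding fin_supp_def by (rule finite_subset[OF _ finite_imageI])
qed

lemma plane_sum_add:
  assumes "fin_supp f" "fin_supp h"
  shows "plane_sum (\<lambda>x y. f x y + h x y) = plane_sum f + plane_sum h"
proof -
  let ?X = "{(x, y). f x y \<noteq> 0} \<union> {(x, y). h x y \<noteq> 0}"
  have finX: "finite ?X" using assms unfolding fin_supp_def by simp
  have "plane_sum f = (\<Sum>(x, y)\<in>?X. f x y)" "plane_sum h = (\<Sum>(x, y)\<in>?X. h x y)"
    "plane_sum (\<lambda>x y. f x y + h x y) = (\<Sum>(x, y)\<in>?X. f x y + h x y)"
    by (rule plane_sum_eq[OF finX]; auto)+
  then show ?thesis by (simp add: sum.distrib case_prod_beta)
qed

lemma plane_sum_cmul: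
  assumes "fin_supp f"
  shows "plane_sum (\<lambda>x y. c * f x y) = c * plane_sum f"
proof -
  let ?X = "{(x, y). f x y \<noteq> 0}"
  have finX: "finite ?X" using assms unfolding fin_supp_def by simp
  have "plane_sum f = (\<Sum>(x, y)\<in>?X. f x y)" "plane_sum (\<lambda>x y. c * f x y) = (\<Sum>(x, y)\<in>?X. c * f x y)"
    by (rule plane_sum_eq[OF finX]; auto)+
  then show ?thesis by (simp add: sum_distrib_left case_prod_beta)
qed

lemma plane_sum_diff:
  assumes "fin_supp f" "fin_supp h"
  shows "plane_sum (\<lambda>x y. f x y - h x y) = plane_sum f - plane_sum h"
  using plane_sum_add[OF assms(1) fin_supp_cmul[OF assms(2), of "-1"]] plane_sum_cmul[OF assms(2), of "-1"] by simp

lemma fin_supp_diff: "fin_supp f \<Longrightarrow> fin_supp h \<Longrightarrow> fin_supp (\<lambda>x y. f x y - h x y)"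
  using fin_supp_add[OF _ fin_supp_cmul[of h "-1"], of f] by simp

lemma plane_sum_mono:
  assumes "fin_supp f" "fin_supp h" "\<And>x y. f x y \<le> h x y"
  shows "plane_sum f \<le> plane_sum h"
proof -
  let ?X = "{(x, y). f x y \<noteq> 0} \<union> {(x, y). h x y \<noteq> 0}"
  have finX: "finite ?X" using assms unfolding fin_supp_def by simp
  have "plane_sum f = (\<Sum>(x, y)\<in>?X. f x y)" "plane_sum h = (\<Sum>(x, y)\<in>?X. h x y)"
    by (rule plane_sum_eq[OF finX]; auto)+
  then show ?thesis using assms(3) by (auto intro!: sum_mono)
qed

lemma plane_sum_shift: "plane_sum (\<lambda>x y. f (x + a) (y + b)) = plane_sum f"
  unfolding plane_sum_def
  by (rule sum.reindex_bij_witness[where i = "\<lambda>(x, y). (x - a, y - b)" and j = "\<lambda>(x, y). (x + a, y + b)"])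
    auto

text \<open>For an infinite set both sides take the default value 0.\<close>

lemma plane_sum_of_bool:
  "plane_sum (\<lambda>x y. of_bool (P x y)) = int (card {(x, y). P x y})"
  unfolding plane_sum_def by (simp add: case_prod_beta of_bool_def)

lemma fin_supp_of_bool: "finite {(x, y). P x y} \<Longrightarrow> fin_supp (\<lambda>x y. of_bool (P x y))"
  unfolding fin_supp_def by (rule finite_subset[rotated], assumption) auto

section \<open>Layers and the potential\<close>

text \<open>
  The point \<open>(x, y, c - x - y)\<close> of layer \<open>c\<close> is encoded as \<open>(x, y)\<close>. For a layer \<open>A\<close>,
  \<open>tri_count A x y\<close> counts the points of \<open>A\<close> in \<open>E(a)\<close> where \<open>a\<close> is the point
  \<open>(x, y)\<close> one layer above, and \<open>up_count A x y\<close> counts the points of \<open>A\<close> in the inverted triangle, which are the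
  points \<open>m + e\<^sub>j\<close> where \<open>m\<close> is the point \<open>(x, y)\<close> one layer below.
\<close>

definition tri_count :: "(int \<Rightarrow> int \<Rightarrow> bool) \<Rightarrow> int \<Rightarrow> int \<Rightarrow> int" where
  "tri_count A x y = of_bool (A x y) + of_bool (A (x - 1) y) + of_bool (A x (y - 1))"

definition up_count :: "(int \<Rightarrow> int \<Rightarrow> bool) \<Rightarrow> int \<Rightarrow> int \<Rightarrow> int" where
  "up_count A x y = of_bool (A x y) + of_bool (A (x + 1) y) + of_bool (A x (y + 1))"

definition fin_pred :: "(int \<Rightarrow> int \<Rightarrow> bool) \<Rightarrow> bool" where
  "fin_pred A \<longleftrightarrow> finite {(x, y). A x y}"

lemma fin_supp_indicator: "fin_pred A \<Longrightarrow> fin_supp (\<lambda>x y. of_bool (A x y))"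
  unfolding fin_pred_def by (rule fin_supp_of_bool)

lemma fin_supp_tri_count: "fin_pred A \<Longrightarrow> fin_supp (tri_count A)"
  using fin_supp_add[OF fin_supp_add[OF fin_supp_indicator[of A] fin_supp_shift[OF fin_supp_indicator, of A "-1" 0]] fin_supp_shift[OF fin_supp_indicator, of A 0 "-1"]]
  by (simp add: tri_count_def[abs_def])

lemma fin_supp_up_count: "fin_pred A \<Longrightarrow> fin_supp (up_count A)"
  using fin_supp_add[OF fin_supp_add[OF fin_supp_indicator[of A] fin_supp_shift[OF fin_supp_indicator, of A 1 0]] fin_supp_shift[OF fin_supp_indicator, of A 0 1]]
  by (simp add: up_count_def[abs_def])

text \<open>Every point lies in exactly three triangles, so three shifted copies of the indicator
  are summed.\<close>

lemma plane_sum_tri_count: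
  assumes "fin_pred A" shows "plane_sum (tri_count A) = 3 * plane_sum (\<lambda>x y. of_bool (A x y))"
proof -
  note i = fin_supp_indicator[OF assms]
  have "plane_sum (tri_count A) = plane_sum (\<lambda>x y. of_bool (A x y)) + plane_sum (\<lambda>x y. of_bool (A (x + -1) (y + 0)))
      + plane_sum (\<lambda>x y. of_bool (A (x + 0) (y + -1)))"
    using plane_sum_add[OF fin_supp_add[OF i fin_supp_shift[OF i, of "-1" 0]] fin_supp_shift[OF i, of 0 "-1"]]
      plane_sum_add[OF i fin_supp_shift[OF i, of "-1" 0]]
    by (simp add: tri_count_def[abs_def])
  then show ?thesis unfolding plane_sum_shift[where f = "\<lambda>x y. of_bool (A x y)"] by simp
qed

lemma plane_sum_up_count:
  assumes "fin_pred A" shows "plane_sum (up_count A) = 3 * plane_sum (\<lambda>x y. of_bool (A x y))"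
proof -
  note i = fin_supp_indicator[OF assms]
  have "plane_sum (up_count A) = plane_sum (\<lambda>x y. of_bool (A x y)) + plane_sum (\<lambda>x y. of_bool (A (x + 1) (y + 0)))
      + plane_sum (\<lambda>x y. of_bool (A (x + 0) (y + 1)))"
    using plane_sum_add[OF fin_supp_add[OF i fin_supp_shift[OF i, of 1 0]] fin_supp_shift[OF i, of 0 1]]
      plane_sum_add[OF i fin_supp_shift[OF i, of 1 0]]
    by (simp add: up_count_def[abs_def])
  then show ?thesis unfolding plane_sum_shift[where f = "\<lambda>x y. of_bool (A x y)"] by simp
qed

lemma plane_sum_shift3:
  assumes "fin_supp f" "fin_supp g" "fin_supp h"
  shows "plane_sum (\<lambda>x y. f (x + a) (y + b) + g (x + c) (y + d) + h (x + i) (y + j)) = plane_sum f + plane_sum g + plane_sum h"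
  using plane_sum_add[OF fin_supp_add[OF fin_supp_shift[OF assms(1), of a b] fin_supp_shift[OF assms(2), of c d]] fin_supp_shift[OF assms(3), of i j]]
    plane_sum_add[OF fin_supp_shift[OF assms(1), of a b] fin_supp_shift[OF assms(2), of c d]]
    plane_sum_shift[of f a b] plane_sum_shift[of g c d] plane_sum_shift[of h i j]
  by simp

lemma plane_sum_shift3_eq:
  assumes "fin_supp f" "fin_supp g" "fin_supp h"
  shows "plane_sum (\<lambda>x y. f (x + a) (y + b) + g (x + c) (y + d) + h (x + i) (y + j))
    = plane_sum (\<lambda>x y. f x y + g x y + h x y)"
  using plane_sum_shift3[OF assms] plane_sum_shift3[OF assms, of 0 0 0 0 0 0] by simp

text \<open>The binomial coefficient \<open>r\<close> choose 2 for \<open>0 \<le> r \<le> 3\<close>,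
  that is, the number of pairs among \<open>r\<close> points of a triangle.\<close>

definition pair_count :: "int \<Rightarrow> int" where
  "pair_count r = (if r = 2 then 1 else if r = 3 then 3 else 0)"

text \<open>Two adjacent lattice points lie together in exactly one triangle and in exactly one
  inverted triangle, so both sides count the adjacent pairs of \<open>A\<close>. The functions
  \<open>p1\<close>, \<open>p2\<close>, \<open>p3\<close> are the three directions of such a
  pair.\<close>

lemma plane_sum_pair_count:
  assumes "fin_pred A" shows "plane_sum (\<lambda>x y. pair_count (tri_count A x y)) = plane_sum (\<lambda>x y. pair_count (up_count A x y))"
proof -
  define p1 where "p1 x y = (of_bool (A x y \<and> A (x + 1) y) :: int)" for x y
  define p2 where "p2 x y = (of_bool (A x y \<and> A x (y + 1)) :: int)" for x y
  define p3 where "p3 x y = (of_bool (A (x + 1) y \<and> A x (y + 1)) :: int)" for x y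
  have f: "fin_supp p1" "fin_supp p2" "fin_supp p3"
    by (rule fin_supp_dominated[OF fin_supp_up_count[OF assms]]; auto simp: p1_def p2_def p3_def up_count_def of_bool_def split: if_splits)+
  have "pair_count (tri_count A x y) = p1 (x + -1) (y + 0) + p2 (x + 0) (y + -1) + p3 (x + -1) (y + -1)" for x y
    by (auto simp: p1_def p2_def p3_def tri_count_def pair_count_def)
  moreover have "pair_count (up_count A x y) = p1 x y + p2 x y + p3 x y" for x y
    by (auto simp: p1_def p2_def p3_def up_count_def pair_count_def)
  ultimately show ?thesis using plane_sum_shift3_eq[OF f, of "-1" 0 0 "-1" "-1" "-1"] by presburger
qed

section \<open>The potential of a signed layer\<close>

definition tri_mono :: "(int \<Rightarrow> int \<Rightarrow> bool) \<Rightarrow> (int \<Rightarrow> int \<Rightarrow> bool) \<Rightarrow> int \<Rightarrow> int \<Rightarrow> bool" where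
  "tri_mono A g x y \<longleftrightarrow> (A x y \<and> A (x - 1) y \<longrightarrow> g x y = g (x - 1) y) \<and>
     (A x y \<and> A x (y - 1) \<longrightarrow> g x y = g x (y - 1)) \<and>
     (A (x - 1) y \<and> A x (y - 1) \<longrightarrow> g (x - 1) y = g x (y - 1))"

text \<open>With nothing above, the value is twice the indicator of a node minus the number of pairs
  of equal sign in the triangle. For three points this is 2 - 3 if all signs agree and 0 - 1
  otherwise, hence -1 in both cases.\<close>

definition phi :: "(int \<Rightarrow> int \<Rightarrow> bool) \<Rightarrow> (int \<Rightarrow> int \<Rightarrow> bool) \<Rightarrow> int \<Rightarrow> int \<Rightarrow> int" where
  "phi A g x y = (if tri_count A x y = 1 then 2 else if tri_count A x y = 2 then of_bool (tri_mono A g x y)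
     else if tri_count A x y = 3 then -1 else 0)"

text \<open>The second term compensates for the subtracted pairs: a full inverted triangle contains
  a pair of equal sign, and each pair lies in only one inverted triangle.\<close>

definition Phi :: "(int \<Rightarrow> int \<Rightarrow> bool) \<Rightarrow> (int \<Rightarrow> int \<Rightarrow> bool) \<Rightarrow> int" where
  "Phi A g = plane_sum (phi A g) + plane_sum (\<lambda>x y. of_bool (up_count A x y = 3))"

lemma fin_supp_tri: "fin_pred A \<Longrightarrow> (\<And>x y. tri_count A x y = 0 \<Longrightarrow> f x y = 0) \<Longrightarrow> fin_supp f"
  by (rule fin_supp_dominated[OF fin_supp_tri_count])

lemma fin_supp_up: "fin_pred A \<Longrightarrow> (\<And>x y. up_count A x y = 0 \<Longrightarrow> f x y = 0) \<Longrightarrow> fin_supp f"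
  by (rule fin_supp_dominated[OF fin_supp_up_count])

lemma fin_supp_phi: "fin_pred A \<Longrightarrow> fin_supp (phi A g)"
  by (rule fin_supp_tri) (auto simp: phi_def)

section \<open>Linear relations between the triangle counts\<close>

definition num_tri :: "(int \<Rightarrow> int \<Rightarrow> bool) \<Rightarrow> int \<Rightarrow> int" where
  "num_tri A i = plane_sum (\<lambda>x y. of_bool (tri_count A x y = i))"
definition num_up :: "(int \<Rightarrow> int \<Rightarrow> bool) \<Rightarrow> int \<Rightarrow> int" where
  "num_up A i = plane_sum (\<lambda>x y. of_bool (up_count A x y = i))"
definition num_pts :: "(int \<Rightarrow> int \<Rightarrow> bool) \<Rightarrow> int" where
  "num_pts A = plane_sum (\<lambda>x y. of_bool (A x y))"

lemma tri_count_cases: "tri_count A x y = 0 \<or> tri_count A x y = 1 \<or> tri_count A x y = 2 \<or> tri_count A x y = 3"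
  by (auto simp: tri_count_def)
lemma up_count_cases: "up_count A x y = 0 \<or> up_count A x y = 1 \<or> up_count A x y = 2 \<or> up_count A x y = 3"
  by (auto simp: up_count_def)

lemma fin_supp_tri_count_eq: "fin_pred A \<Longrightarrow> i \<noteq> 0 \<Longrightarrow> fin_supp (\<lambda>x y. of_bool (tri_count A x y = i))"
  by (rule fin_supp_tri) auto
lemma fin_supp_up_count_eq: "fin_pred A \<Longrightarrow> i \<noteq> 0 \<Longrightarrow> fin_supp (\<lambda>x y. of_bool (up_count A x y = i))"
  by (rule fin_supp_up) auto

text \<open>The first two count incidences of points and triangles, the third counts adjacent pairs.
  Together they make \<open>num_tri A 1 - num_up A 2\<close> three times the Euler characteristic of
  the complex of points, adjacent pairs and full triangles of both kinds.\<close>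

lemma count_identities:
  assumes "fin_pred A"
  shows "num_tri A 1 + 2 * num_tri A 2 + 3 * num_tri A 3 = 3 * num_pts A"
    and "num_up A 1 + 2 * num_up A 2 + 3 * num_up A 3 = 3 * num_pts A"
    and "num_tri A 2 + 3 * num_tri A 3 = num_up A 2 + 3 * num_up A 3"
proof -
  have e: "fin_supp (\<lambda>x y. of_bool (tri_count A x y = 1))" "fin_supp (\<lambda>x y. of_bool (tri_count A x y = 2))" "fin_supp (\<lambda>x y. of_bool (tri_count A x y = 3))"
    and u: "fin_supp (\<lambda>x y. of_bool (up_count A x y = 1))" "fin_supp (\<lambda>x y. of_bool (up_count A x y = 2))" "fin_supp (\<lambda>x y. of_bool (up_count A x y = 3))"
    using fin_supp_tri_count_eq[OF assms] fin_supp_up_count_eq[OF assms] by simp_all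
  have "plane_sum (tri_count A) = plane_sum (\<lambda>x y. of_bool (tri_count A x y = 1) + 2 * of_bool (tri_count A x y = 2) + 3 * of_bool (tri_count A x y = 3))"
    by (rule arg_cong[of _ _ plane_sum], intro ext) (use tri_count_cases[of A] in fastforce)
  also have "\<dots> = num_tri A 1 + 2 * num_tri A 2 + 3 * num_tri A 3"
    using plane_sum_add[OF fin_supp_add[OF e(1) fin_supp_cmul[OF e(2), of 2]] fin_supp_cmul[OF e(3), of 3]]
      plane_sum_add[OF e(1) fin_supp_cmul[OF e(2), of 2]] plane_sum_cmul[OF e(2), of 2] plane_sum_cmul[OF e(3), of 3]
    unfolding num_tri_def by linarith
  finally show "num_tri A 1 + 2 * num_tri A 2 + 3 * num_tri A 3 = 3 * num_pts A"
    using plane_sum_tri_count[OF assms] unfolding num_pts_def by linarith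
  have "plane_sum (up_count A) = plane_sum (\<lambda>x y. of_bool (up_count A x y = 1) + 2 * of_bool (up_count A x y = 2) + 3 * of_bool (up_count A x y = 3))"
    by (rule arg_cong[of _ _ plane_sum], intro ext) (use up_count_cases[of A] in fastforce)
  also have "\<dots> = num_up A 1 + 2 * num_up A 2 + 3 * num_up A 3"
    using plane_sum_add[OF fin_supp_add[OF u(1) fin_supp_cmul[OF u(2), of 2]] fin_supp_cmul[OF u(3), of 3]]
      plane_sum_add[OF u(1) fin_supp_cmul[OF u(2), of 2]] plane_sum_cmul[OF u(2), of 2] plane_sum_cmul[OF u(3), of 3]
    unfolding num_up_def by linarith
  finally show "num_up A 1 + 2 * num_up A 2 + 3 * num_up A 3 = 3 * num_pts A"
    using plane_sum_up_count[OF assms] unfolding num_pts_def by linarith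
  have "plane_sum (\<lambda>x y. pair_count (tri_count A x y)) = plane_sum (\<lambda>x y. of_bool (tri_count A x y = 2) + 3 * of_bool (tri_count A x y = 3))"
    "plane_sum (\<lambda>x y. pair_count (up_count A x y)) = plane_sum (\<lambda>x y. of_bool (up_count A x y = 2) + 3 * of_bool (up_count A x y = 3))"
    by (rule arg_cong[of _ _ plane_sum], intro ext, simp add: pair_count_def)+
  then show "num_tri A 2 + 3 * num_tri A 3 = num_up A 2 + 3 * num_up A 3"
    using plane_sum_pair_count[OF assms] plane_sum_add[OF e(2) fin_supp_cmul[OF e(3), of 3]] plane_sum_cmul[OF e(3), of 3]
      plane_sum_add[OF u(2) fin_supp_cmul[OF u(3), of 3]] plane_sum_cmul[OF u(3), of 3]
    unfolding num_tri_def num_up_def by linarith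
qed

lemma tri_count_eq_0: "tri_count A x y = 0 \<longleftrightarrow> \<not> A x y \<and> \<not> A (x - 1) y \<and> \<not> A x (y - 1)"
  by (simp add: tri_count_def of_bool_def)
lemma tri_count_ge_1: "tri_count A x y \<ge> 1 \<longleftrightarrow> A x y \<or> A (x - 1) y \<or> A x (y - 1)"
  by (simp add: tri_count_def of_bool_def)
lemma up_count_eq_0: "up_count A x y = 0 \<longleftrightarrow> \<not> A x y \<and> \<not> A (x + 1) y \<and> \<not> A x (y + 1)"
  by (simp add: up_count_def of_bool_def)
lemma up_count_eq_3: "up_count A x y = 3 \<longleftrightarrow> A x y \<and> A (x + 1) y \<and> A x (y + 1)"
  by (simp add: up_count_def of_bool_def)

section \<open>Counting the nodes between two layers\<close>

text \<open>\<open>S\<close> is the layer containing the position itself, \<open>U\<close> the one below; a sign function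
  sends the points marked \<open>P\<close> to \<open>True\<close>.\<close>

definition node_at :: "(int \<Rightarrow> int \<Rightarrow> bool) \<Rightarrow> (int \<Rightarrow> int \<Rightarrow> bool) \<Rightarrow> (int \<Rightarrow> int \<Rightarrow> bool) \<Rightarrow> (int \<Rightarrow> int \<Rightarrow> bool)
    \<Rightarrow> int \<Rightarrow> int \<Rightarrow> bool" where
  "node_at S gS U gU x y \<longleftrightarrow> (S x y \<or> U x y \<or> U (x - 1) y \<or> U x (y - 1)) \<and>
     (\<exists>s. (S x y \<longrightarrow> gS x y = s) \<and> (U x y \<longrightarrow> gU x y = s) \<and>
       (U (x - 1) y \<longrightarrow> gU (x - 1) y = s) \<and> (U x (y - 1) \<longrightarrow> gU x (y - 1) = s))"

section \<open>The charging scheme\<close>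

text \<open>A point of sign \<open>s\<close> is charged once for each pair of points below it that is
  incomplete, unless the only point of that pair that is present has sign \<open>s\<close>.\<close>

definition charge :: "bool \<Rightarrow> bool \<Rightarrow> bool \<Rightarrow> bool \<Rightarrow> bool \<Rightarrow> int" where
  "charge s a ga b gb = of_bool (\<not> (a \<and> b)) - of_bool ((a \<and> ga = s \<and> \<not> b) \<or> (b \<and> gb = s \<and> \<not> a))"

text \<open>All charges collected at one position a: \<open>f1\<close>, \<open>f2\<close>,
  \<open>f3\<close> stand for a - e_1, a - e_2, a - e_3, and \<open>w1\<close>, \<open>w2\<close>,
  \<open>w3\<close> for the points one level further down, \<open>w3\<close> being a - e_1 - e_2.
  The point \<open>o3\<close> completes \<open>f1\<close>, \<open>f2\<close> to an inverted
  triangle, and the assumptions say that the lower set contains the erosion of the upper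
  one.\<close>

lemma charge_position:
  assumes "f2 \<and> f3 \<and> o1 \<longrightarrow> w1" "f1 \<and> f3 \<and> o2 \<longrightarrow> w2" "f1 \<and> f2 \<and> o3 \<longrightarrow> w3"
  shows "of_bool f1 * charge h1 w3 g3 w2 g2 + of_bool f2 * charge h2 w3 g3 w1 g1 + of_bool f3 * charge h3 w2 g2 w1 g1
    \<le> of_bool ((f1 \<or> f2 \<or> f3) \<and> \<not> (w1 \<and> w2 \<and> w3))
      + of_bool (of_bool f3 + of_bool f1 + of_bool f2 = (2::int) \<and>
          (f3 \<and> f1 \<longrightarrow> h3 = h1) \<and> (f3 \<and> f2 \<longrightarrow> h3 = h2) \<and> (f1 \<and> f2 \<longrightarrow> h1 = h2))
      + (of_bool (f1 \<and> f2 \<and> \<not> o3) + of_bool (f1 \<and> f3 \<and> \<not> o2) + of_bool (f2 \<and> f3 \<and> \<not> o1))"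
  using assms
  by (cases f1; cases f2; cases f3; cases w1; cases w2; cases w3; auto simp: charge_def)

text \<open>Here \<open>s\<close> is the sign of a point and \<open>w1\<close>, \<open>w2\<close>,
  \<open>w3\<close> are the points below it. In its two pairs a lone point below costs nothing if
  its sign is \<open>s\<close> and 2 otherwise, while an empty pair costs 1. A node \<open>n\<close>
  is needed only when the triangle is neither empty nor full and carries no sign but
  \<open>s\<close>.\<close>

lemma charge_point:
  assumes "\<not> (w1 \<and> w2 \<and> w3) \<Longrightarrow> w1 \<or> w2 \<or> w3 \<Longrightarrow> (w1 \<longrightarrow> g1 = s) \<Longrightarrow> (w2 \<longrightarrow> g2 = s) \<Longrightarrow> (w3 \<longrightarrow> g3 = s) \<Longrightarrow> n"
    and "(r::int) = of_bool w3 + of_bool w1 + of_bool w2"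
    and "m = ((w3 \<and> w1 \<longrightarrow> g3 = g1) \<and> (w3 \<and> w2 \<longrightarrow> g3 = g2) \<and> (w1 \<and> w2 \<longrightarrow> g1 = g2))"
  shows "1 + (if r = 1 then 2 else if r = 2 then of_bool m else if r = 3 then -1 else (0::int)) - 2 * of_bool n
    \<le> charge s w2 g2 w3 g3 + charge s w1 g1 w3 g3 + charge s w1 g1 w2 g2"
  using assms
  by (cases w1; cases w2; cases w3; auto simp: charge_def)

text \<open>By \<open>count_identities\<close> the left-hand side equals 4/3 times
  \<open>num_tri F 1 - num_up F 2\<close>.\<close>

lemma euler_count:
  assumes "fin_pred F" "num_tri F 1 - num_up F 2 \<ge> 3"
  shows "2 * num_tri F 1 + num_up F 3 - num_tri F 3 + num_pts F - (num_tri F 1 + num_tri F 2 + num_tri F 3) - num_up F 2 \<ge> 4"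
  using count_identities[OF assms(1)] assms(2) by linarith

lemma Phi_counts:
  assumes "fin_pred A"
  shows "Phi A g = 2 * num_tri A 1 - num_tri A 3 + plane_sum (\<lambda>x y. of_bool (tri_count A x y = 2 \<and> tri_mono A g x y)) + num_up A 3"
proof -
  have e: "fin_supp (\<lambda>x y. of_bool (tri_count A x y = 1))" "fin_supp (\<lambda>x y. of_bool (tri_count A x y = 3))"
    using fin_supp_tri_count_eq[OF assms] by simp_all
  have m: "fin_supp (\<lambda>x y. of_bool (tri_count A x y = 2 \<and> tri_mono A g x y))"
    by (rule fin_supp_tri[OF assms]) auto
  have "plane_sum (phi A g) = plane_sum (\<lambda>x y. 2 * of_bool (tri_count A x y = 1) - of_bool (tri_count A x y = 3)
      + of_bool (tri_count A x y = 2 \<and> tri_mono A g x y))"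
    by (rule arg_cong[of _ _ plane_sum], intro ext) (simp add: phi_def)
  also have "\<dots> = 2 * num_tri A 1 - num_tri A 3 + plane_sum (\<lambda>x y. of_bool (tri_count A x y = 2 \<and> tri_mono A g x y))"
    using plane_sum_add[OF fin_supp_diff[OF fin_supp_cmul[OF e(1), of 2] e(2)] m]
      plane_sum_diff[OF fin_supp_cmul[OF e(1), of 2] e(2)] plane_sum_cmul[OF e(1), of 2]
    unfolding num_tri_def by linarith
  finally show ?thesis unfolding Phi_def num_up_def by linarith
qed

lemma num_tri_pos:
  assumes "fin_pred F"
  shows "plane_sum (\<lambda>x y. of_bool (tri_count F x y \<ge> 1)) = num_tri F 1 + num_tri F 2 + num_tri F 3"
proof -
  have e: "fin_supp (\<lambda>x y. of_bool (tri_count F x y = 1))" "fin_supp (\<lambda>x y. of_bool (tri_count F x y = 2))" "fin_supp (\<lambda>x y. of_bool (tri_count F x y = 3))"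
    using fin_supp_tri_count_eq[OF assms] by simp_all
  have "plane_sum (\<lambda>x y. of_bool (tri_count F x y \<ge> 1))
    = plane_sum (\<lambda>x y. of_bool (tri_count F x y = 1) + of_bool (tri_count F x y = 2) + of_bool (tri_count F x y = 3))"
    by (rule arg_cong[of _ _ plane_sum], intro ext) (simp add: tri_count_def of_bool_def)
  then show ?thesis
    using plane_sum_add[OF fin_supp_add[OF e(1,2)] e(3)] plane_sum_add[OF e(1,2)] unfolding num_tri_def by linarith
qed

lemma fin_supp_node_at: "fin_pred S \<Longrightarrow> fin_pred U \<Longrightarrow> fin_supp (\<lambda>x y. of_bool (node_at S gS U gU x y))"
  by (rule fin_supp_dominated[OF fin_supp_add[OF fin_supp_indicator[of S] fin_supp_tri_count[of U]]]) (auto simp: node_at_def tri_count_def of_bool_def split: if_splits)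

text \<open>Two of the three signs on a full inverted triangle agree.\<close>

lemma uncovered_count:
  fixes g :: "int \<Rightarrow> int \<Rightarrow> bool"
  assumes "fin_pred W" "fin_pred F"
  shows "plane_sum (\<lambda>x y. of_bool (\<not> F x y) * (of_bool (W x y \<and> W (x - 1) y \<and> g x y = g (x - 1) y)
      + of_bool (W x y \<and> W x (y - 1) \<and> g x y = g x (y - 1))
      + of_bool (W (x - 1) y \<and> W x (y - 1) \<and> g (x - 1) y = g x (y - 1))))
    \<ge> num_up W 3 - plane_sum (\<lambda>x y. of_bool (up_count W (x - 1) (y - 1) = 3 \<and> tri_count F x y \<ge> 1))"
proof -
  \<comment> \<open>The three possible pairs of equal sign in the inverted triangle at
    \<open>(x, y)\<close>, each restricted to the case that the position whose triangle contains the
    pair is outside \<open>F\<close>. These three positions form the triangle of \<open>F\<close>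
    that \<open>L\<close> inspects.\<close>
  define q1 where "q1 x y = (of_bool (\<not> F (x + 1) y \<and> W x y \<and> W (x + 1) y \<and> g x y = g (x + 1) y) :: int)" for x y
  define q2 where "q2 x y = (of_bool (\<not> F x (y + 1) \<and> W x y \<and> W x (y + 1) \<and> g x y = g x (y + 1)) :: int)" for x y
  define q3 where "q3 x y = (of_bool (\<not> F (x + 1) (y + 1) \<and> W (x + 1) y \<and> W x (y + 1) \<and> g (x + 1) y = g x (y + 1)) :: int)" for x y
  define L where "L x y = (of_bool (up_count W x y = 3 \<and> tri_count F (x + 1) (y + 1) \<ge> 1) :: int)" for x y
  have f: "fin_supp q1" "fin_supp q2" "fin_supp q3"
    by (rule fin_supp_up[OF assms(1)]; simp add: q1_def q2_def q3_def up_count_eq_0)+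
  have L: "fin_supp L" by (rule fin_supp_up[OF assms(1)]) (auto simp: L_def)
  have "plane_sum (\<lambda>x y. of_bool (\<not> F x y) * (of_bool (W x y \<and> W (x - 1) y \<and> g x y = g (x - 1) y)
      + of_bool (W x y \<and> W x (y - 1) \<and> g x y = g x (y - 1))
      + of_bool (W (x - 1) y \<and> W x (y - 1) \<and> g (x - 1) y = g x (y - 1))))
    = plane_sum (\<lambda>x y. q1 (x + -1) (y + 0) + q2 (x + 0) (y + -1) + q3 (x + -1) (y + -1))"
    by (rule arg_cong[of _ _ plane_sum], intro ext) (auto simp: q1_def q2_def q3_def)
  also have "\<dots> = plane_sum (\<lambda>x y. q1 x y + q2 x y + q3 x y)" by (rule plane_sum_shift3_eq[OF f])
  finally have 1: "plane_sum (\<lambda>x y. of_bool (\<not> F x y) * (of_bool (W x y \<and> W (x - 1) y \<and> g x y = g (x - 1) y)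
      + of_bool (W x y \<and> W x (y - 1) \<and> g x y = g x (y - 1))
      + of_bool (W (x - 1) y \<and> W x (y - 1) \<and> g (x - 1) y = g x (y - 1)))) = plane_sum (\<lambda>x y. q1 x y + q2 x y + q3 x y)" .
  have "num_up W 3 \<le> plane_sum (\<lambda>x y. (q1 x y + q2 x y + q3 x y) + L x y)"
    unfolding num_up_def
  proof (rule plane_sum_mono)
    show "fin_supp (\<lambda>x y. of_bool (up_count W x y = 3))" using fin_supp_up_count_eq[OF assms(1)] by simp
    show "fin_supp (\<lambda>x y. (q1 x y + q2 x y + q3 x y) + L x y)" by (intro fin_supp_add f L)
    show "of_bool (up_count W x y = 3) \<le> (q1 x y + q2 x y + q3 x y) + L x y" for x y
    proof (cases "up_count W x y = 3")
      case True
      then have w: "W x y" "W (x + 1) y" "W x (y + 1)" by (simp_all add: up_count_eq_3)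
      have "g x y = g (x + 1) y \<or> g x y = g x (y + 1) \<or> g (x + 1) y = g x (y + 1)"
        by auto
      moreover have "L x y = of_bool (F (x + 1) (y + 1) \<or> F x (y + 1) \<or> F (x + 1) y)"
        using True by (auto simp: L_def tri_count_def)
      ultimately show ?thesis using True w by (auto simp: q1_def q2_def q3_def)
    qed (auto simp: q1_def q2_def q3_def L_def)
  qed
  also have "\<dots> = plane_sum (\<lambda>x y. q1 x y + q2 x y + q3 x y) + plane_sum L"
    by (intro plane_sum_add fin_supp_add f L)
  also have "plane_sum L = plane_sum (\<lambda>x y. L (x + -1) (y + -1))" by (rule plane_sum_shift[symmetric])
  also have "\<dots> = plane_sum (\<lambda>x y. of_bool (up_count W (x - 1) (y - 1) = 3 \<and> tri_count F x y \<ge> 1))"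
    by (rule arg_cong[of _ _ plane_sum], intro ext) (auto simp: L_def)
  finally show ?thesis unfolding 1 by linarith
qed

text \<open>With nothing above, \<open>2 * node - phi\<close> is at each position the number of
  pairs of equal sign, and there are at least as many such pairs as full inverted triangles. This
  starts the descent.\<close>

lemma Phi_le_nodes:
  assumes "fin_pred W"
  shows "Phi W g \<le> 2 * plane_sum (\<lambda>x y. of_bool (node_at (\<lambda>_ _. False) h W g x y))"
proof -
  have fe: "fin_pred (\<lambda>_ _. False)" by (simp add: fin_pred_def)
  note n = fin_supp_node_at[OF fe assms, of h g]
  have "2 * plane_sum (\<lambda>x y. of_bool (node_at (\<lambda>_ _. False) h W g x y)) - plane_sum (phi W g)
     = plane_sum (\<lambda>x y. 2 * of_bool (node_at (\<lambda>_ _. False) h W g x y) - phi W g x y)"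
    using plane_sum_diff[OF fin_supp_cmul[OF n, of 2] fin_supp_phi[OF assms, of g]] plane_sum_cmul[OF n, of 2] by linarith
  also have "\<dots> = plane_sum (\<lambda>x y. of_bool (\<not> False) * (of_bool (W x y \<and> W (x - 1) y \<and> g x y = g (x - 1) y)
      + of_bool (W x y \<and> W x (y - 1) \<and> g x y = g x (y - 1))
      + of_bool (W (x - 1) y \<and> W x (y - 1) \<and> g (x - 1) y = g x (y - 1))))"
    by (rule arg_cong[of _ _ plane_sum], intro ext) (auto simp: node_at_def phi_def tri_count_def tri_mono_def)
  also have "\<dots> \<ge> num_up W 3 - plane_sum (\<lambda>x y. of_bool (up_count W (x - 1) (y - 1) = 3 \<and> tri_count (\<lambda>_ _. False) x y \<ge> 1))"
    by (rule uncovered_count[OF assms fe])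
  also have "plane_sum (\<lambda>x y. of_bool (up_count W (x - 1) (y - 1) = 3 \<and> tri_count (\<lambda>_ _. False) x y \<ge> 1)) = 0"
    by (simp add: tri_count_def plane_sum_def)
  finally show ?thesis unfolding Phi_def num_up_def by linarith
qed

section \<open>One step of the descent\<close>

text \<open>The points of \<open>W - U\<close> and \<open>V - S\<close> are not in the diagram and have opposite signs. Hence below a point of
  \<open>V - S\<close>, all points of \<open>W\<close> that have its sign belong to the diagram, and the charged nodes are genuine.\<close>

lemma step_count:
  fixes U W S V F gV gW :: "int \<Rightarrow> int \<Rightarrow> bool"
  assumes W: "fin_pred W" and F: "fin_pred F"
    and UW: "\<And>x y. U x y \<Longrightarrow> W x y"
    and WU: "\<And>x y. W x y \<Longrightarrow> \<not> U x y \<Longrightarrow> F x y \<and> F (x + 1) y \<and> F x (y + 1) \<and> gW x y = b"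
    and eW: "\<And>x y. F x y \<Longrightarrow> F (x + 1) y \<Longrightarrow> F x (y + 1) \<Longrightarrow> W x y"
    and SV: "\<And>x y. S x y \<Longrightarrow> V x y" and VF: "\<And>x y. V x y \<Longrightarrow> F x y"
    and VS: "\<And>x y. V x y \<Longrightarrow> \<not> S x y \<Longrightarrow> gV x y = (\<not> b)"
    and FV: "\<And>x y. F x y \<Longrightarrow> \<not> V x y \<Longrightarrow> F (x + 1) y \<and> F (x - 1) y \<and> F x (y + 1) \<and> F x (y - 1)
        \<and> F (x + 1) (y - 1) \<and> F (x - 1) (y + 1)"
    and eul: "num_tri F 1 - num_up F 2 \<ge> 3"
  shows "2 * plane_sum (\<lambda>x y. of_bool (node_at S gV U gW x y)) \<ge> Phi W gW - Phi F gV + 4"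
proof -
  define N where "N x y = node_at S gV U gW x y" for x y
  define P where "P x y = (of_bool (\<not> F x y) * (of_bool (W x y \<and> W (x - 1) y \<and> gW x y = gW (x - 1) y)
      + of_bool (W x y \<and> W x (y - 1) \<and> gW x y = gW x (y - 1))
      + of_bool (W (x - 1) y \<and> W x (y - 1) \<and> gW (x - 1) y = gW x (y - 1))) :: int)" for x y
  \<comment> \<open>A point m of \<open>F\<close> has three pairs of points below it;
    \<open>f1\<close>, \<open>f2\<close>, \<open>f3\<close> are its charges for the pairs omitting m
    - e_1, m - e_2, m - e_3.\<close>
  define f1 where "f1 x y = of_bool (F x y) * charge (gV x y) (W x (y - 1)) (gW x (y - 1)) (W x y) (gW x y)" for x y
  define f2 where "f2 x y = of_bool (F x y) * charge (gV x y) (W (x - 1) y) (gW (x - 1) y) (W x y) (gW x y)" for x y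
  define f3 where "f3 x y = of_bool (F x y) * charge (gV x y) (W (x - 1) y) (gW (x - 1) y) (W x (y - 1)) (gW x (y - 1))" for x y
  \<comment> \<open>\<open>L\<close> and \<open>sv\<close> split the positions above
    \<open>F\<close> according to whether the inverted triangle of \<open>W\<close> two levels down
    is full.\<close>
  define L where "L x y = (of_bool (up_count W (x - 1) (y - 1) = 3 \<and> tri_count F x y \<ge> 1) :: int)" for x y
  define sv where "sv x y = (of_bool (tri_count F x y \<ge> 1 \<and> up_count W (x - 1) (y - 1) \<noteq> 3) :: int)" for x y
  define M where "M x y = (of_bool (tri_count F x y = 2 \<and> tri_mono F gV x y) :: int)" for x y
  \<comment> \<open>The inverted triangles with exactly two points of \<open>F\<close>, sorted by
    the missing point.\<close>
  define z1 where "z1 x y = (of_bool (F (x + 1) y \<and> F x (y + 1) \<and> \<not> F x y) :: int)" for x y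
  define z2 where "z2 x y = (of_bool (F x y \<and> F (x + 1) y \<and> \<not> F x (y + 1)) :: int)" for x y
  define z3 where "z3 x y = (of_bool (F x (y + 1) \<and> F x y \<and> \<not> F (x + 1) y) :: int)" for x y
  have SF: "F x y" if "S x y" for x y using SV VF that by blast
  have "fin_pred S" using F SF unfolding fin_pred_def by (auto elim!: finite_subset[rotated])
  moreover have "fin_pred U" using W UW unfolding fin_pred_def by (auto elim!: finite_subset[rotated])
  ultimately have fN: "fin_supp (\<lambda>x y. of_bool (N x y))" unfolding N_def by (rule fin_supp_node_at)
  have fP: "fin_supp P" by (rule fin_supp_tri[OF W]) (auto simp: P_def tri_count_eq_0)
  have ff: "fin_supp f1" "fin_supp f2" "fin_supp f3"
    by (rule fin_supp_dominated[OF fin_supp_indicator[OF F]]; simp add: f1_def f2_def f3_def)+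
  have fL: "fin_supp L" "fin_supp sv" "fin_supp M" by (rule fin_supp_tri[OF F]; simp add: L_def sv_def M_def)+
  have fz: "fin_supp z1" "fin_supp z2" "fin_supp z3" by (rule fin_supp_up[OF F]; simp add: z1_def z2_def z3_def up_count_eq_0)+
  have low: "P x y + (of_bool (F x y) - (f1 x y + f2 x y + f3 x y)) \<le> 2 * of_bool (N x y) - phi W gW x y" for x y
  proof (cases "F x y")
    case False
    \<comment> \<open>A point of \<open>W\<close> outside \<open>U\<close> has all three points
      above it in \<open>F\<close>. So below a position outside \<open>F\<close> only points of the
      diagram occur, and \<open>P\<close> is exactly the difference on the right.\<close>
    then have "W x y = U x y" "W (x - 1) y = U (x - 1) y" "W x (y - 1) = U x (y - 1)" "\<not> S x y"
      using UW WU[of x y] WU[of "x - 1" y] WU[of x "y - 1"] SF by auto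
    then show ?thesis using False
      by (auto simp: P_def f1_def f2_def f3_def N_def node_at_def phi_def tri_count_def tri_mono_def)
  next
    case True
    have n: "N x y" if w: "\<not> (W (x - 1) y \<and> W x (y - 1) \<and> W x y)" "W (x - 1) y \<or> W x (y - 1) \<or> W x y"
      and s: "W (x - 1) y \<longrightarrow> gW (x - 1) y = gV x y" "W x (y - 1) \<longrightarrow> gW x (y - 1) = gV x y"
        "W x y \<longrightarrow> gW x y = gV x y"
    proof -
      have V: "V x y"
      \<comment> \<open>A filled-in point has all six neighbours in \<open>F\<close>, so the three
        points below it lie in the erosion and hence in \<open>W\<close>.\<close>
      proof (rule ccontr)
        assume "\<not> V x y"
        from FV[OF True this] True show False
          using w(1) eW[of x y] eW[of "x - 1" y] eW[of x "y - 1"] by auto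
      qed
      show ?thesis
      proof (cases "S x y")
        case True
        then show ?thesis unfolding N_def node_at_def using s UW by blast
      next
        case False
        \<comment> \<open>Points of \<open>W\<close> outside \<open>U\<close> have sign
          \<open>b\<close>, so they cannot agree with this sign.\<close>
        then have "gV x y = (\<not> b)" using VS V by blast
        then have "W x y \<longrightarrow> U x y" "W (x - 1) y \<longrightarrow> U (x - 1) y" "W x (y - 1) \<longrightarrow> U x (y - 1)"
          using s WU by metis+
        then show ?thesis unfolding N_def node_at_def using s UW w(2) False by blast
      qed
    qed
    have "1 + phi W gW x y - 2 * of_bool (N x y)
        \<le> charge (gV x y) (W x (y - 1)) (gW x (y - 1)) (W x y) (gW x y)
          + charge (gV x y) (W (x - 1) y) (gW (x - 1) y) (W x y) (gW x y)
          + charge (gV x y) (W (x - 1) y) (gW (x - 1) y) (W x (y - 1)) (gW x (y - 1))"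
      unfolding phi_def
    proof (rule charge_point)
      show "tri_count W x y = of_bool (W x y) + of_bool (W (x - 1) y) + of_bool (W x (y - 1))" by (rule tri_count_def)
    qed (use n in \<open>auto simp: tri_mono_def\<close>)
    then show ?thesis using True by (simp add: P_def f1_def f2_def f3_def)
  qed
  \<comment> \<open>The charge of m for the pair omitting m - e_l is moved to the position m +
    e_l.\<close>
  have kF: "f1 (x - 1) y + f2 x (y - 1) + f3 x y \<le> (sv x y + M x y) + (z1 (x - 1) (y - 1) + z2 (x - 1) y + z3 x (y - 1))" for x y
  proof -
    have e: "sv x y = of_bool ((F (x - 1) y \<or> F x (y - 1) \<or> F x y) \<and> \<not> (W x (y - 1) \<and> W (x - 1) y \<and> W (x - 1) (y - 1)))"
      by (auto simp: sv_def up_count_eq_3 tri_count_ge_1)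
    have m: "M x y = of_bool (of_bool (F x y) + of_bool (F (x - 1) y) + of_bool (F x (y - 1)) = (2::int) \<and>
        (F x y \<and> F (x - 1) y \<longrightarrow> gV x y = gV (x - 1) y) \<and> (F x y \<and> F x (y - 1) \<longrightarrow> gV x y = gV x (y - 1)) \<and>
        (F (x - 1) y \<and> F x (y - 1) \<longrightarrow> gV (x - 1) y = gV x (y - 1)))"
      by (simp only: M_def tri_count_def tri_mono_def)
    have z: "z1 (x - 1) (y - 1) = of_bool (F (x - 1) y \<and> F x (y - 1) \<and> \<not> F (x - 1) (y - 1))"
      "z2 (x - 1) y = of_bool (F (x - 1) y \<and> F x y \<and> \<not> F (x - 1) (y + 1))"
      "z3 x (y - 1) = of_bool (F x (y - 1) \<and> F x y \<and> \<not> F (x + 1) (y - 1))"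
      by (auto simp: z1_def z2_def z3_def)
    show ?thesis unfolding e m z f1_def f2_def f3_def
      by (rule charge_position) (use eW[of x "y - 1"] eW[of "x - 1" y] eW[of "x - 1" "y - 1"] in auto)
  qed
  have "plane_sum (\<lambda>x y. P x y + (of_bool (F x y) - (f1 x y + f2 x y + f3 x y)))
      \<le> plane_sum (\<lambda>x y. 2 * of_bool (N x y) - phi W gW x y)"
    by (intro plane_sum_mono fin_supp_add fin_supp_diff fP ff fin_supp_indicator[OF F] fin_supp_cmul[OF fN] fin_supp_phi[OF W] low)
  moreover have "plane_sum (\<lambda>x y. 2 * of_bool (N x y) - phi W gW x y) = 2 * plane_sum (\<lambda>x y. of_bool (N x y)) - plane_sum (phi W gW)"
    using plane_sum_diff[OF fin_supp_cmul[OF fN, of 2] fin_supp_phi[OF W, of gW]] plane_sum_cmul[OF fN, of 2] by linarith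
  moreover have "plane_sum (\<lambda>x y. P x y + (of_bool (F x y) - (f1 x y + f2 x y + f3 x y)))
      = plane_sum P + (num_pts F - plane_sum (\<lambda>x y. f1 x y + f2 x y + f3 x y))"
    using plane_sum_add[OF fP fin_supp_diff[OF fin_supp_indicator[OF F] fin_supp_add[OF fin_supp_add[OF ff(1,2)] ff(3)]]]
      plane_sum_diff[OF fin_supp_indicator[OF F] fin_supp_add[OF fin_supp_add[OF ff(1,2)] ff(3)]] unfolding num_pts_def by linarith
  moreover have "plane_sum P \<ge> num_up W 3 - plane_sum L"
    using uncovered_count[OF W F, of gW] unfolding P_def[abs_def] L_def[abs_def] .
  moreover have "plane_sum (\<lambda>x y. f1 x y + f2 x y + f3 x y) \<le> plane_sum sv + plane_sum M + num_up F 2"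
  proof -
    have "plane_sum (\<lambda>x y. f1 x y + f2 x y + f3 x y)
        = plane_sum (\<lambda>x y. f1 (x + -1) (y + 0) + f2 (x + 0) (y + -1) + f3 (x + 0) (y + 0))"
      by (rule plane_sum_shift3_eq[OF ff, symmetric])
    also have "\<dots> \<le> plane_sum (\<lambda>x y. (sv x y + M x y)
        + (z1 (x + -1) (y + -1) + z2 (x + -1) (y + 0) + z3 (x + 0) (y + -1)))"
    proof (intro plane_sum_mono fin_supp_add fin_supp_shift ff fL fz)
      show "f1 (x + -1) (y + 0) + f2 (x + 0) (y + -1) + f3 (x + 0) (y + 0) \<le> (sv x y + M x y)
        + (z1 (x + -1) (y + -1) + z2 (x + -1) (y + 0) + z3 (x + 0) (y + -1))" for x y
        using kF[of x y] by simp
    qed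
    also have "\<dots> = plane_sum sv + plane_sum M + plane_sum (\<lambda>x y. z1 (x + -1) (y + -1) + z2 (x + -1) (y + 0) + z3 (x + 0) (y + -1))"
      using plane_sum_add[OF fin_supp_add[OF fL(2,3)]
          fin_supp_add[OF fin_supp_add[OF fin_supp_shift[OF fz(1), of "-1" "-1"] fin_supp_shift[OF fz(2), of "-1" 0]] fin_supp_shift[OF fz(3), of 0 "-1"]]]
        plane_sum_add[OF fL(2,3)] by linarith
    also have "plane_sum (\<lambda>x y. z1 (x + -1) (y + -1) + z2 (x + -1) (y + 0) + z3 (x + 0) (y + -1))
        = plane_sum (\<lambda>x y. z1 x y + z2 x y + z3 x y)"
      by (rule plane_sum_shift3_eq[OF fz])
    also have "\<dots> = num_up F 2" unfolding num_up_def
      by (rule arg_cong[of _ _ plane_sum], intro ext) (auto simp: z1_def z2_def z3_def up_count_def)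
    finally show ?thesis .
  qed
  moreover have "plane_sum L + plane_sum sv = num_tri F 1 + num_tri F 2 + num_tri F 3"
  proof -
    have "plane_sum L + plane_sum sv = plane_sum (\<lambda>x y. L x y + sv x y)" by (rule plane_sum_add[OF fL(1,2), symmetric])
    also have "\<dots> = plane_sum (\<lambda>x y. of_bool (tri_count F x y \<ge> 1))"
      by (rule arg_cong[of _ _ plane_sum], intro ext) (simp add: L_def sv_def)
    finally show ?thesis using num_tri_pos[OF F] by linarith
  qed
  moreover have "Phi F gV = 2 * num_tri F 1 - num_tri F 3 + plane_sum M + num_up F 3"
    using Phi_counts[OF F, of gV] unfolding M_def[abs_def] .
  moreover have "Phi W gW = plane_sum (phi W gW) + num_up W 3" unfolding Phi_def num_up_def ..
  \<comment> \<open>The terms in \<open>plane_sum M\<close> and \<open>num_up W 3\<close> cancel;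
    what remains is the quantity bounded below by 4 in \<open>euler_count\<close>.\<close>
  ultimately show ?thesis
    using euler_count[OF F eul] unfolding N_def by linarith
qed

section \<open>Hole-free sets\<close>

definition pt_in :: "(int \<times> int) set \<Rightarrow> int \<Rightarrow> int \<Rightarrow> bool" where
  "pt_in F x y \<longleftrightarrow> (x, y) \<in> F"

lemma fin_pred_pt_in: "finite F \<Longrightarrow> fin_pred (pt_in F)"
  unfolding fin_pred_def pt_in_def by simp

definition nbr :: "int \<times> int \<Rightarrow> (int \<times> int) set" where
  "nbr p = (case p of (x, y) \<Rightarrow> {(x + 1, y), (x - 1, y), (x, y + 1), (x, y - 1), (x + 1, y - 1), (x - 1, y + 1)})"

lemma nbr_sym: "q \<in> nbr p \<longleftrightarrow> p \<in> nbr q"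
  unfolding nbr_def by (cases p; cases q) auto

text \<open>A nonempty finite union of finite connected components of the complement.\<close>

definition hole :: "(int \<times> int) set \<Rightarrow> (int \<times> int) set \<Rightarrow> bool" where
  "hole F Y \<longleftrightarrow> finite Y \<and> Y \<noteq> {} \<and> Y \<inter> F = {} \<and> (\<forall>p\<in>Y. nbr p \<subseteq> Y \<union> F)"

definition hole_free :: "(int \<times> int) set \<Rightarrow> bool" where
  "hole_free F \<longleftrightarrow> (\<forall>Y. \<not> hole F Y)"

lemma ex_argmax:
  fixes h :: "'a \<Rightarrow> int"
  assumes "finite Y" "Y \<noteq> {}"
  obtains p where "p \<in> Y" "\<And>q. q \<in> Y \<Longrightarrow> h q \<le> h p"
proof -
  have "Max (h ` Y) \<in> h ` Y" using assms by simp
  then obtain p where "p \<in> Y" "h p = Max (h ` Y)" by auto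
  then show ?thesis using that[of p] Max_ge[of "h ` Y"] assms(1) by simp
qed

lemma ex_argmin:
  fixes h :: "'a \<Rightarrow> int"
  assumes "finite Y" "Y \<noteq> {}"
  obtains p where "p \<in> Y" "\<And>q. q \<in> Y \<Longrightarrow> h p \<le> h q"
  by (rule ex_argmax[OF assms, of "\<lambda>p. - h p"]) (use that in simp)

text \<open>A maximum principle: at a maximum of \<open>h\<close> on \<open>Y\<close>, a neighbour
  with larger value must lie in \<open>F\<close>.\<close>

lemma hole_bounded:
  fixes h :: "int \<times> int \<Rightarrow> int"
  assumes "hole F Y" "\<And>p. \<exists>q\<in>nbr p. h q > h p" "\<And>p. p \<in> F \<Longrightarrow> h p \<le> B" "p \<in> Y"
  shows "h p \<le> B"
proof -
  obtain r where r: "r \<in> Y" "\<And>q. q \<in> Y \<Longrightarrow> h q \<le> h r"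
    using ex_argmax[of Y h] assms(1) unfolding hole_def by blast
  obtain q where q: "q \<in> nbr r" "h q > h r" using assms(2) by blast
  then have "q \<notin> Y" using r(2)[of q] by linarith
  then have "q \<in> F" using q(1) r(1) assms(1) unfolding hole_def by blast
  then show ?thesis using q(2) r(2)[OF assms(4)] assms(3)[of q] by linarith
qed

section \<open>Enlarging a hole-free set inside a triangle\<close>

definition triangle :: "int \<Rightarrow> (int \<times> int) set" where
  "triangle M = {(x, y). x \<ge> -M \<and> y \<ge> -M \<and> x + y \<le> M}"

lemma finite_triangle: "finite (triangle M)"
  by (rule finite_subset[of _ "{-M..2 * M} \<times> {-M..2 * M}"]) (auto simp: triangle_def)

lemma in_triangle:
  assumes "finite F" obtains M where "F \<subseteq> triangle M"
proof -
  define M where "M = Max (insert 0 ((\<lambda>p. \<bar>fst p\<bar> + \<bar>snd p\<bar>) ` F))"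
  have "\<bar>fst p\<bar> + \<bar>snd p\<bar> \<le> M" if "p \<in> F" for p
    unfolding M_def using assms that by (intro Max_ge) auto
  then have "F \<subseteq> triangle M" unfolding triangle_def by fastforce
  then show ?thesis using that by blast
qed

lemma hole_in_triangle:
  assumes "hole F Y" "F \<subseteq> triangle M" shows "Y \<subseteq> triangle M"
proof
  fix p assume p: "p \<in> Y"
  have "- fst p \<le> M"
    by (rule hole_bounded[OF assms(1) _ _ p, of "\<lambda>p. - fst p"]) (use assms(2) in \<open>auto simp: nbr_def triangle_def\<close>)
  moreover have "- snd p \<le> M"
    by (rule hole_bounded[OF assms(1) _ _ p, of "\<lambda>p. - snd p"]) (use assms(2) in \<open>auto simp: nbr_def triangle_def\<close>)
  moreover have "fst p + snd p \<le> M"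
    by (rule hole_bounded[OF assms(1) _ _ p, of "\<lambda>p. fst p + snd p"]) (use assms(2) in \<open>auto simp: nbr_def triangle_def\<close>)
  ultimately show "p \<in> triangle M" unfolding triangle_def by (cases p) auto
qed

text \<open>If every extension by a point next to \<open>F\<close> had a hole, then a smallest such hole \<open>Y\<close>, say of
  \<open>insert x F\<close>, would contain a point \<open>y\<close> next to \<open>F\<close>, and a hole of \<open>insert y F\<close> would either cut \<open>Y\<close>
  down to a smaller hole or join with it to a hole of \<open>F\<close>.\<close>

lemma ex_extension:
  assumes F: "F \<noteq> {}" "F \<subset> triangle M" and hf: "hole_free F"
  obtains x where "x \<in> triangle M - F" "nbr x \<inter> F \<noteq> {}" "hole_free (insert x F)"
proof (rule ccontr)
  note ext = that
  assume "\<not> thesis"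
  then have bad: "\<exists>Y. hole (insert x F) Y" if "x \<in> triangle M - F" "nbr x \<inter> F \<noteq> {}" for x
    using ext that unfolding hole_free_def by blast
  define Q where "Q n \<longleftrightarrow> (\<exists>x Y. x \<in> triangle M - F \<and> nbr x \<inter> F \<noteq> {} \<and> hole (insert x F) Y \<and> card Y = n)" for n
  have "\<exists>x \<in> triangle M - F. nbr x \<inter> F \<noteq> {}"
  proof (rule ccontr)
    assume no: "\<not> ?thesis"
    \<comment> \<open>Otherwise membership in \<open>F\<close> does not change along unit steps
      inside the triangle. Then lowest points of \<open>F\<close> and of its complement can both be
      pushed down to the corner \<open>(-M, -M)\<close>, which cannot lie in both.\<close>
    obtain p where p: "p \<in> triangle M - F" "\<And>q. q \<in> triangle M - F \<Longrightarrow> fst p + snd p \<le> fst q + snd q"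
      using ex_argmin[of "triangle M - F" "\<lambda>p. fst p + snd p"] F finite_triangle by blast
    obtain r where r: "r \<in> F" "\<And>q. q \<in> F \<Longrightarrow> fst r + snd r \<le> fst q + snd q"
      using ex_argmin[of F "\<lambda>p. fst p + snd p"] F finite_subset[OF _ finite_triangle[of M]] by blast
    have "q \<in> F \<longleftrightarrow> q' \<in> F" if "q' \<in> nbr q" "q \<in> triangle M" "q' \<in> triangle M" for q q'
      using no that nbr_sym[of q q'] by blast
    then have step: "(u, v) \<in> F \<longleftrightarrow> (u - 1, v) \<in> F" if "(u, v) \<in> triangle M" "(u - 1, v) \<in> triangle M" for u v
      using that by (auto simp: nbr_def)
    have step': "(u, v) \<in> F \<longleftrightarrow> (u, v - 1) \<in> F" if "(u, v) \<in> triangle M" "(u, v - 1) \<in> triangle M" for u v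
      using that \<open>\<And>q' q. _ \<Longrightarrow> _ \<Longrightarrow> _ \<Longrightarrow> (q \<in> F) = (q' \<in> F)\<close> by (auto simp: nbr_def)
    have "p = (-M, -M)"
    proof (rule ccontr)
      assume a: "p \<noteq> (-M, -M)"
      obtain u v where uv: "p = (u, v)" by force
      then have "(u - 1, v) \<in> triangle M \<or> (u, v - 1) \<in> triangle M" using a p(1) by (auto simp: triangle_def)
      then have "(u - 1, v) \<in> triangle M - F \<or> (u, v - 1) \<in> triangle M - F"
        using step step' p(1) uv by blast
      then show False using p(2)[of "(u - 1, v)"] p(2)[of "(u, v - 1)"] uv by auto
    qed
    moreover have "r = (-M, -M)"
    proof (rule ccontr)
      assume a: "r \<noteq> (-M, -M)"
      obtain u v where uv: "r = (u, v)" by force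
      then have t: "(u, v) \<in> triangle M" using r(1) F(2) by blast
      then have "(u - 1, v) \<in> triangle M \<or> (u, v - 1) \<in> triangle M" using a uv by (auto simp: triangle_def)
      then have "(u - 1, v) \<in> F \<or> (u, v - 1) \<in> F"
        using step step' r(1) uv t by blast
      then show False using r(2)[of "(u - 1, v)"] r(2)[of "(u, v - 1)"] uv by auto
    qed
    ultimately show False using p(1) r(1) by blast
  qed
  then have "\<exists>n. Q n" unfolding Q_def using bad by blast
  then obtain n where "Q n" and least: "\<And>m. m < n \<Longrightarrow> \<not> Q m" using exists_least_iff[of Q] by blast
  then obtain x Y where x: "x \<in> triangle M - F" and Y: "hole (insert x F) Y" and n: "card Y = n"
    unfolding Q_def by blast
  have YF: "finite Y" "Y \<noteq> {}" "Y \<inter> F = {}" "x \<notin> Y" "\<And>p q. p \<in> Y \<Longrightarrow> q \<in> nbr p \<Longrightarrow> q \<in> Y \<or> q \<in> F \<or> q = x"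
    using Y unfolding hole_def by auto
  have YI: "Y \<subseteq> triangle M" using hole_in_triangle[OF Y, of M] x F(2) by blast
  \<comment> \<open>An extreme point \<open>y\<close> of \<open>Y\<close> has two neighbours outside
    \<open>Y\<close>. At most one of them is \<open>x\<close>, so the other lies in
    \<open>F\<close>.\<close>
  obtain p where p: "p \<in> Y" "\<And>q. q \<in> Y \<Longrightarrow> fst q \<le> fst p" using ex_argmax[OF YF(1,2), of fst] by blast
  obtain y where y0: "y \<in> {q \<in> Y. fst q = fst p}" "\<And>q. q \<in> {q \<in> Y. fst q = fst p} \<Longrightarrow> snd q \<le> snd y"
    by (rule ex_argmax[of "{q \<in> Y. fst q = fst p}" snd]) (use p(1) YF(1) in \<open>simp, blast, blast\<close>)
  have y: "y \<in> Y" using y0(1) by simp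
  have "(fst y + 1, snd y) \<notin> Y" using p(2) y0(1) by force
  moreover have "(fst y, snd y + 1) \<notin> Y" using y0 by force
  moreover have "(fst y + 1, snd y) \<in> nbr y" "(fst y, snd y + 1) \<in> nbr y" by (cases y; simp add: nbr_def)+
  ultimately have "nbr y \<inter> F \<noteq> {}"
    using YF(5)[OF y, of "(fst y + 1, snd y)"] YF(5)[OF y, of "(fst y, snd y + 1)"] by auto
  moreover have yI: "y \<in> triangle M - F" using y YI YF(3) by blast
  ultimately obtain Y' where Y': "hole (insert y F) Y'" using bad by blast
  have Y'F: "finite Y'" "Y' \<noteq> {}" "Y' \<inter> F = {}" "y \<notin> Y'" "\<And>p q. p \<in> Y' \<Longrightarrow> q \<in> nbr p \<Longrightarrow> q \<in> Y' \<or> q \<in> F \<or> q = y"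
    using Y' unfolding hole_def by auto
  show False
  proof (cases "x \<in> Y'")
    case True
    have "hole F (Y \<union> Y')" unfolding hole_def
      using YF Y'F True y by blast
    then show False using hf unfolding hole_free_def by blast
  next
    case False
    show False
    proof (cases "Y \<inter> Y' = {}")
      case True
      \<comment> \<open>Since \<open>Y'\<close> is not a hole of \<open>F\<close>, it contains a
        neighbour of \<open>y\<close>. This neighbour would have to lie in \<open>Y\<close>, in
        \<open>F\<close> or equal \<open>x\<close>, all of which are excluded.\<close>
      have "\<not> hole F Y'" using hf unfolding hole_free_def by blast
      then obtain q where q: "q \<in> Y'" "y \<in> nbr q" using Y'F unfolding hole_def by blast
      then have "q \<in> nbr y" using nbr_sym by blast
      then show False using YF(5)[OF y, of q] q(1) True False Y'F(3) by blast
    next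
      case ne: False
      have "hole (insert y F) (Y \<inter> Y')" unfolding hole_def
        using YF(1,3,5) Y'F(3,4,5) ne False by blast
      moreover have "card (Y \<inter> Y') < n"
        unfolding n[symmetric] using y Y'F(4) YF(1) by (intro psubset_card_mono) auto
      ultimately show False using least[of "card (Y \<inter> Y')"] yI \<open>nbr y \<inter> F \<noteq> {}\<close> unfolding Q_def by blast
    qed
  qed
qed

section \<open>The Euler characteristic when a point is added\<close>

text \<open>The \<open>a\<^sub>i\<close> tell which of the six neighbours of a new point are present; the two sides are the
  resulting changes of \<open>num_tri 1\<close> and \<open>num_up 2\<close>.\<close>

lemma hexagon:
  assumes "a1 \<or> a2 \<or> a3 \<or> a4 \<or> a5 \<or> a6" "\<not> (a1 \<and> a2 \<and> a3 \<and> a4 \<and> a5 \<and> a6)"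
  shows "(of_bool (\<not> a2 \<and> \<not> a4) - of_bool (a2 \<noteq> a4)) + (of_bool (\<not> a1 \<and> \<not> a5) - of_bool (a1 \<noteq> a5))
      + (of_bool (\<not> a3 \<and> \<not> a6) - of_bool (a3 \<noteq> a6))
    \<le> (of_bool (a1 \<noteq> a3) - of_bool (a1 \<and> a3)) + (of_bool (a2 \<noteq> a6) - of_bool (a2 \<and> a6))
      + (of_bool (a4 \<noteq> a5) - of_bool (a4 \<and> a5) :: int)"
  using assms by (cases a1; cases a2; cases a3; cases a4; cases a5; cases a6; simp)

text \<open>The neighbours of \<open>p\<close> that are present form at least one arc of the hexagon
  and not the whole hexagon, so adding \<open>p\<close> changes the Euler characteristic by one
  minus the number of arcs. Only three triangles and three inverted triangles contain
  \<open>p\<close>.\<close>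

lemma insert_count:
  assumes F: "finite F" and p: "p \<notin> F" "nbr p \<inter> F \<noteq> {}" "\<not> nbr p \<subseteq> F"
  shows "num_tri (pt_in (insert p F)) 1 - num_up (pt_in (insert p F)) 2 \<le> num_tri (pt_in F) 1 - num_up (pt_in F) 2"
proof -
  obtain x y where xy: "p = (x, y)" by force
  define G where "G = insert p F"
  have f: "fin_pred (pt_in F)" "fin_pred (pt_in G)" using F by (auto intro!: fin_pred_pt_in simp: G_def)
  have m: "pt_in G u v \<longleftrightarrow> pt_in F u v \<or> (u = x \<and> v = y)" for u v by (auto simp: pt_in_def G_def xy)
  have "num_tri (pt_in G) 1 - num_tri (pt_in F) 1 = plane_sum (\<lambda>u v. of_bool (tri_count (pt_in G) u v = 1) - of_bool (tri_count (pt_in F) u v = 1))"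
    unfolding num_tri_def by (rule plane_sum_diff[symmetric]) (use f in \<open>auto intro: fin_supp_tri_count_eq\<close>)
  also have "\<dots> = (\<Sum>(u, v)\<in>{(x, y), (x + 1, y), (x, y + 1)}. of_bool (tri_count (pt_in G) u v = 1) - of_bool (tri_count (pt_in F) u v = 1))"
    by (rule plane_sum_eq) (auto simp: tri_count_def m)
  also have "\<dots> = (of_bool (tri_count (pt_in G) x y = 1) - of_bool (tri_count (pt_in F) x y = 1))
      + (of_bool (tri_count (pt_in G) (x + 1) y = 1) - of_bool (tri_count (pt_in F) (x + 1) y = 1))
      + (of_bool (tri_count (pt_in G) x (y + 1) = 1) - of_bool (tri_count (pt_in F) x (y + 1) = 1))"
    by simp
  finally have e: "num_tri (pt_in G) 1 - num_tri (pt_in F) 1 = \<dots>" .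
  have "num_up (pt_in G) 2 - num_up (pt_in F) 2 = plane_sum (\<lambda>u v. of_bool (up_count (pt_in G) u v = 2) - of_bool (up_count (pt_in F) u v = 2))"
    unfolding num_up_def by (rule plane_sum_diff[symmetric]) (use f in \<open>auto intro: fin_supp_up_count_eq\<close>)
  also have "\<dots> = (\<Sum>(u, v)\<in>{(x, y), (x - 1, y), (x, y - 1)}. of_bool (up_count (pt_in G) u v = 2) - of_bool (up_count (pt_in F) u v = 2))"
    by (rule plane_sum_eq) (auto simp: up_count_def m)
  also have "\<dots> = (of_bool (up_count (pt_in G) x y = 2) - of_bool (up_count (pt_in F) x y = 2))
      + (of_bool (up_count (pt_in G) (x - 1) y = 2) - of_bool (up_count (pt_in F) (x - 1) y = 2))
      + (of_bool (up_count (pt_in G) x (y - 1) = 2) - of_bool (up_count (pt_in F) x (y - 1) = 2))"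
    by simp
  finally have u: "num_up (pt_in G) 2 - num_up (pt_in F) 2 = \<dots>" .
  have n0: "\<not> pt_in F x y" using p(1) by (simp add: pt_in_def xy)
  have n1: "pt_in F (x + 1) y \<or> pt_in F (x - 1) y \<or> pt_in F x (y + 1) \<or> pt_in F x (y - 1) \<or> pt_in F (x + 1) (y - 1) \<or> pt_in F (x - 1) (y + 1)"
    and n2: "\<not> (pt_in F (x + 1) y \<and> pt_in F (x - 1) y \<and> pt_in F x (y + 1) \<and> pt_in F x (y - 1) \<and> pt_in F (x + 1) (y - 1) \<and> pt_in F (x - 1) (y + 1))"
    using p(2,3) by (auto simp: pt_in_def xy nbr_def)
  have "num_tri (pt_in G) 1 - num_tri (pt_in F) 1 \<le> num_up (pt_in G) 2 - num_up (pt_in F) 2"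
  proof -
    have ge: "of_bool (tri_count (pt_in G) x y = 1) = (of_bool (\<not> pt_in F (x - 1) y \<and> \<not> pt_in F x (y - 1)) :: int)"
      "of_bool (tri_count (pt_in G) (x + 1) y = 1) = (of_bool (\<not> pt_in F (x + 1) y \<and> \<not> pt_in F (x + 1) (y - 1)) :: int)"
      "of_bool (tri_count (pt_in G) x (y + 1) = 1) = (of_bool (\<not> pt_in F x (y + 1) \<and> \<not> pt_in F (x - 1) (y + 1)) :: int)"
      "of_bool (tri_count (pt_in F) x y = 1) = (of_bool (pt_in F (x - 1) y \<noteq> pt_in F x (y - 1)) :: int)"
      "of_bool (tri_count (pt_in F) (x + 1) y = 1) = (of_bool (pt_in F (x + 1) y \<noteq> pt_in F (x + 1) (y - 1)) :: int)"
      "of_bool (tri_count (pt_in F) x (y + 1) = 1) = (of_bool (pt_in F x (y + 1) \<noteq> pt_in F (x - 1) (y + 1)) :: int)"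
      using n0 by (auto simp: tri_count_def m)
    have gu: "of_bool (up_count (pt_in F) x y = 2) = (of_bool (pt_in F (x + 1) y \<and> pt_in F x (y + 1)) :: int)"
      "of_bool (up_count (pt_in F) (x - 1) y = 2) = (of_bool (pt_in F (x - 1) y \<and> pt_in F (x - 1) (y + 1)) :: int)"
      "of_bool (up_count (pt_in F) x (y - 1) = 2) = (of_bool (pt_in F x (y - 1) \<and> pt_in F (x + 1) (y - 1)) :: int)"
      "of_bool (up_count (pt_in G) x y = 2) = (of_bool (pt_in F (x + 1) y \<noteq> pt_in F x (y + 1)) :: int)"
      "of_bool (up_count (pt_in G) (x - 1) y = 2) = (of_bool (pt_in F (x - 1) y \<noteq> pt_in F (x - 1) (y + 1)) :: int)"
      "of_bool (up_count (pt_in G) x (y - 1) = 2) = (of_bool (pt_in F x (y - 1) \<noteq> pt_in F (x + 1) (y - 1)) :: int)"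
      using n0 by (auto simp: up_count_def m)
    show ?thesis unfolding e u ge gu by (rule hexagon[OF n1 n2])
  qed
  then show ?thesis unfolding G_def by linarith
qed

text \<open>The extreme points in the three directions (largest x, largest y, smallest x + y) are
  each alone in some triangle.\<close>

lemma num_tri_1_ge_3:
  assumes "finite F" "F \<noteq> {}"
  shows "num_tri (pt_in F) 1 \<ge> 3"
proof -
  obtain p where p: "p \<in> F" "\<And>q. q \<in> F \<Longrightarrow> fst q \<le> fst p" using ex_argmax[OF assms, of fst] by blast
  obtain q where q: "q \<in> F" "\<And>r. r \<in> F \<Longrightarrow> snd r \<le> snd q" using ex_argmax[OF assms, of snd] by blast
  obtain r where r: "r \<in> F" "\<And>q. q \<in> F \<Longrightarrow> fst r + snd r \<le> fst q + snd q"
    using ex_argmin[OF assms, of "\<lambda>p. fst p + snd p"] by blast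
  let ?X = "{(fst p + 1, snd p), (fst q, snd q + 1), r}"
  have "card ?X = 3"
    using p(2)[OF q(1)] p(2)[OF r(1)] q(2)[OF r(1)] by (auto simp: card_insert_if)
  moreover have "?X \<subseteq> {(x, y). tri_count (pt_in F) x y = 1}"
  proof -
    have "(fst p + 1, z) \<notin> F" "(z, snd q + 1) \<notin> F" for z
      using p(2)[of "(fst p + 1, z)"] q(2)[of "(z, snd q + 1)"] by auto
    moreover have "(fst r - 1, snd r) \<notin> F" "(fst r, snd r - 1) \<notin> F"
      using r(2)[of "(fst r - 1, snd r)"] r(2)[of "(fst r, snd r - 1)"] by auto
    ultimately show ?thesis using p(1) q(1) r(1) by (auto simp: tri_count_def pt_in_def)
  qed
  moreover have "finite {(x, y). tri_count (pt_in F) x y = 1}"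
    by (rule finite_subset[OF _ fin_supp_tri_count[OF fin_pred_pt_in[OF assms(1)], unfolded fin_supp_def]]) auto
  ultimately have "3 \<le> card {(x, y). tri_count (pt_in F) x y = 1}" by (metis card_mono)
  then show ?thesis unfolding num_tri_def plane_sum_of_bool by linarith
qed

text \<open>The translate of \<open>F\<close> by e_1 consists of such positions, and the extreme
  points in the two other directions provide two more.\<close>

lemma positions_ge:
  assumes "finite F" "F \<noteq> {}"
  shows "num_tri (pt_in F) 1 + num_tri (pt_in F) 2 + num_tri (pt_in F) 3 \<ge> num_pts (pt_in F) + 2"
proof -
  obtain q where q: "q \<in> F" "\<And>r. r \<in> F \<Longrightarrow> snd r \<le> snd q" using ex_argmax[OF assms, of snd] by blast
  obtain r where r: "r \<in> F" "\<And>q. q \<in> F \<Longrightarrow> fst r + snd r \<le> fst q + snd q"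
    using ex_argmin[OF assms, of "\<lambda>p. fst p + snd p"] by blast
  let ?Z = "(\<lambda>(x, y). (x + 1, y)) ` F"
  let ?X = "insert (fst q, snd q + 1) (insert r ?Z)"
  have "card ?Z = card F" by (rule card_image) (auto intro: inj_onI)
  moreover have "r \<notin> ?Z" using r(2) by force
  moreover have "(fst q, snd q + 1) \<notin> ?Z" using q(2) by force
  moreover have "(fst q, snd q + 1) \<noteq> r" using q(2)[OF r(1)] by auto
  ultimately have "card ?X = card F + 2" using assms(1) by simp
  moreover have "?X \<subseteq> {(x, y). tri_count (pt_in F) x y \<ge> 1}"
    using q(1) r(1) by (auto simp: tri_count_ge_1 pt_in_def)
  moreover have "finite {(x, y). tri_count (pt_in F) x y \<ge> 1}"
    by (rule finite_subset[OF _ fin_supp_tri_count[OF fin_pred_pt_in[OF assms(1)], unfolded fin_supp_def]]) auto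
  ultimately have "card F + 2 \<le> card {(x, y). tri_count (pt_in F) x y \<ge> 1}" by (metis card_mono)
  moreover have "num_pts (pt_in F) = int (card F)" unfolding num_pts_def plane_sum_of_bool by (simp add: pt_in_def)
  ultimately show ?thesis unfolding num_tri_pos[OF fin_pred_pt_in[OF assms(1)], symmetric] plane_sum_of_bool by linarith
qed

text \<open>The Euler characteristic of a nonempty hole-free set is at least 1. Points are added one
  by one until \<open>F\<close> is a full triangle; every set on the way is hole-free and no step
  increases the difference.\<close>

lemma hole_free_count:
  assumes "finite F" "F \<noteq> {}" "hole_free F"
  shows "num_tri (pt_in F) 1 - num_up (pt_in F) 2 \<ge> 3"
proof -
  obtain M where "F \<subseteq> triangle M" using in_triangle[OF assms(1)] by blast
  then show ?thesis using assms
  proof (induction "card (triangle M - F)" arbitrary: F rule: less_induct)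
    case less
    show ?case
    proof (cases "F = triangle M")
      case True
      \<comment> \<open>\<open>triangle M\<close> has the orientation of the small triangles counted
        by \<open>up_count\<close>, so none of these meets it in exactly two points.\<close>
      have "up_count (pt_in F) x y \<noteq> 2" for x y
        unfolding True up_count_def pt_in_def triangle_def by auto
      then have "num_up (pt_in F) 2 = 0" unfolding num_up_def by (simp add: plane_sum_def)
      then show ?thesis using num_tri_1_ge_3[OF less.prems(2,3)] by linarith
    next
      case False
      then have "F \<subset> triangle M" using less.prems(1) by blast
      then obtain x where x: "x \<in> triangle M - F" "nbr x \<inter> F \<noteq> {}" "hole_free (insert x F)"
        using ex_extension[OF less.prems(3) _ less.prems(4)] by metis
      \<comment> \<open>A point outside \<open>F\<close> with all neighbours in \<open>F\<close>
        would itself be a hole.\<close>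
      have "\<not> hole F {x}" using less.prems(4) unfolding hole_free_def by blast
      then have "\<not> nbr x \<subseteq> F" unfolding hole_def using x(1) by auto
      then have "num_tri (pt_in (insert x F)) 1 - num_up (pt_in (insert x F)) 2 \<le> num_tri (pt_in F) 1 - num_up (pt_in F) 2"
        using insert_count[OF less.prems(2) _ x(2)] x(1) by blast
      moreover have "card (triangle M - insert x F) < card (triangle M - F)"
        using x(1) finite_triangle by (intro psubset_card_mono) auto
      then have "num_tri (pt_in (insert x F)) 1 - num_up (pt_in (insert x F)) 2 \<ge> 3"
        using less.hyps[of "insert x F"] x less.prems by blast
      ultimately show ?thesis by linarith
    qed
  qed
qed

text \<open>The bound 6 is 4 from \<open>euler_count\<close> plus 2 from
  \<open>positions_ge\<close>; the remaining terms are nonnegative.\<close>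

lemma hole_free_Phi:
  assumes "finite F" "F \<noteq> {}" "hole_free F"
  shows "Phi (pt_in F) g \<ge> 6"
proof -
  note fF = fin_pred_pt_in[OF assms(1)]
  have "plane_sum (\<lambda>x y. of_bool (tri_count (pt_in F) x y = 2 \<and> tri_mono (pt_in F) g x y)) \<ge> 0"
    unfolding plane_sum_of_bool by simp
  moreover have "num_up (pt_in F) 2 \<ge> 0" unfolding num_up_def plane_sum_of_bool by simp
  ultimately show ?thesis
    using Phi_counts[OF fF, of g] euler_count[OF fF hole_free_count[OF assms]] positions_ge[OF assms(1,2)] by linarith
qed

section \<open>Filling the holes of a set\<close>

lemma fill_holes:
  assumes V: "finite V"
  obtains F where "finite F" "V \<subseteq> F" "hole_free F" "\<And>p. p \<in> F - V \<Longrightarrow> nbr p \<subseteq> F" "\<And>g. Phi (pt_in F) g \<le> Phi (pt_in V) g"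
proof -
  obtain M where M: "V \<subseteq> triangle M" using in_triangle[OF V] by blast
  \<comment> \<open>All holes are filled at once; their union is finite because each lies in the
    triangle around \<open>V\<close>.\<close>
  define H where "H = \<Union>{Y. hole V Y}"
  define F where "F = V \<union> H"
  have "H \<subseteq> triangle M" unfolding H_def using hole_in_triangle[OF _ M] by blast
  then have H: "finite H" using finite_triangle finite_subset by blast
  have HV: "H \<inter> V = {}" unfolding H_def hole_def by blast
  have nb: "nbr p \<subseteq> F" if "p \<in> H" for p using that unfolding F_def H_def hole_def by blast
  have F: "finite F" using V H unfolding F_def by simp
  have hf: "hole_free F" unfolding hole_free_def
  proof (intro allI notI)
    fix Y assume Y: "hole F Y"
    \<comment> \<open>A hole of \<open>F\<close> together with the filled points is again a hole of
      \<open>V\<close>, so it was already filled.\<close>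
    then have "hole V (Y \<union> H)" using H HV nb unfolding hole_def F_def by blast
    then have "Y \<subseteq> H" unfolding H_def by blast
    then show False using Y unfolding hole_def F_def by blast
  qed
  have P: "Phi (pt_in F) g \<le> Phi (pt_in V) g" for g
  proof -
    note fF = fin_pred_pt_in[OF F] and fV = fin_pred_pt_in[OF V] and fH = fin_pred_pt_in[OF H]
    have nbH: "pt_in F (x + 1) y \<and> pt_in F (x - 1) y \<and> pt_in F x (y + 1) \<and> pt_in F x (y - 1) \<and> pt_in F (x + 1) (y - 1) \<and> pt_in F (x - 1) (y + 1)"
      if "pt_in H x y" for x y using nb[of "(x, y)"] that by (auto simp: nbr_def pt_in_def)
    have mF: "pt_in F x y \<longleftrightarrow> pt_in V x y \<or> pt_in H x y" for x y by (auto simp: pt_in_def F_def)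
    have mVH: "\<not> (pt_in V x y \<and> pt_in H x y)" for x y using HV by (auto simp: pt_in_def)
    have e: "fin_supp (\<lambda>x y. of_bool (tri_count (pt_in H) x y = 1))" "fin_supp (\<lambda>x y. of_bool (tri_count (pt_in H) x y = 2))" "fin_supp (\<lambda>x y. of_bool (tri_count (pt_in H) x y = 3))"
      and u: "fin_supp (\<lambda>x y. of_bool (up_count (pt_in H) x y = 1))" "fin_supp (\<lambda>x y. of_bool (up_count (pt_in H) x y = 2))" "fin_supp (\<lambda>x y. of_bool (up_count (pt_in H) x y = 3))"
      using fin_supp_tri_count_eq[OF fH] fin_supp_up_count_eq[OF fH] by simp_all
    \<comment> \<open>A triangle meeting \<open>H\<close> becomes full, with value -1. Before the
      filling it had 2, 1 or 0 points and value at least 0, 2 or 0, which gives the coefficients 1,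
      3, 1.\<close>
    have "phi (pt_in F) g x y + (of_bool (tri_count (pt_in H) x y = 1) + 3 * of_bool (tri_count (pt_in H) x y = 2) + of_bool (tri_count (pt_in H) x y = 3))
        \<le> phi (pt_in V) g x y" for x y
    proof (cases "tri_count (pt_in H) x y = 0")
      case True
      then have "pt_in F x y = pt_in V x y" "pt_in F (x - 1) y = pt_in V (x - 1) y" "pt_in F x (y - 1) = pt_in V x (y - 1)"
        using mF by (auto simp: tri_count_eq_0)
      then show ?thesis using True by (simp add: phi_def tri_count_def tri_mono_def)
    next
      case False
      then have "pt_in F x y \<and> pt_in F (x - 1) y \<and> pt_in F x (y - 1)"
        using nbH[of x y] nbH[of "x - 1" y] nbH[of x "y - 1"] mF by (auto simp: tri_count_eq_0)
      then have "tri_count (pt_in F) x y = 3" "tri_count (pt_in V) x y = 3 - tri_count (pt_in H) x y"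
        using mF mVH by (auto simp: tri_count_def)
      then show ?thesis using False tri_count_cases[of "pt_in H" x y] by (auto simp: phi_def)
    qed
    then have "plane_sum (\<lambda>x y. phi (pt_in F) g x y + (of_bool (tri_count (pt_in H) x y = 1) + 3 * of_bool (tri_count (pt_in H) x y = 2) + of_bool (tri_count (pt_in H) x y = 3)))
        \<le> plane_sum (phi (pt_in V) g)"
      by (intro plane_sum_mono fin_supp_add fin_supp_phi fin_supp_cmul e fF fV)
    moreover have "plane_sum (\<lambda>x y. phi (pt_in F) g x y + (of_bool (tri_count (pt_in H) x y = 1) + 3 * of_bool (tri_count (pt_in H) x y = 2) + of_bool (tri_count (pt_in H) x y = 3)))
        = plane_sum (phi (pt_in F) g) + (num_tri (pt_in H) 1 + 3 * num_tri (pt_in H) 2 + num_tri (pt_in H) 3)"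
      using plane_sum_add[OF fin_supp_phi[OF fF, of g] fin_supp_add[OF fin_supp_add[OF e(1) fin_supp_cmul[OF e(2), of 3]] e(3)]]
        plane_sum_add[OF fin_supp_add[OF e(1) fin_supp_cmul[OF e(2), of 3]] e(3)] plane_sum_add[OF e(1) fin_supp_cmul[OF e(2), of 3]]
        plane_sum_cmul[OF e(2), of 3] unfolding num_tri_def by linarith
    \<comment> \<open>Each newly full inverted triangle meets \<open>H\<close>.\<close>
    moreover have "of_bool (up_count (pt_in F) x y = 3) \<le> of_bool (up_count (pt_in V) x y = 3) +
        (of_bool (up_count (pt_in H) x y = 1) + of_bool (up_count (pt_in H) x y = 2) + of_bool (up_count (pt_in H) x y = 3) :: int)" for x y
      using mF by (auto simp: up_count_def)
    then have "num_up (pt_in F) 3 \<le> plane_sum (\<lambda>x y. of_bool (up_count (pt_in V) x y = 3) +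
        (of_bool (up_count (pt_in H) x y = 1) + of_bool (up_count (pt_in H) x y = 2) + of_bool (up_count (pt_in H) x y = 3)))"
      unfolding num_up_def by (intro plane_sum_mono fin_supp_add u fin_supp_up_count_eq fF fV) auto
    moreover have "plane_sum (\<lambda>x y. of_bool (up_count (pt_in V) x y = 3) +
        (of_bool (up_count (pt_in H) x y = 1) + of_bool (up_count (pt_in H) x y = 2) + of_bool (up_count (pt_in H) x y = 3)))
        = num_up (pt_in V) 3 + (num_up (pt_in H) 1 + num_up (pt_in H) 2 + num_up (pt_in H) 3)"
      using plane_sum_add[OF fin_supp_up_count_eq[OF fV, of 3] fin_supp_add[OF fin_supp_add[OF u(1,2)] u(3)]]
        plane_sum_add[OF fin_supp_add[OF u(1,2)] u(3)] plane_sum_add[OF u(1,2)] unfolding num_up_def by linarith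
    moreover have "num_tri (pt_in H) 2 \<ge> 0" "num_up (pt_in H) 2 \<ge> 0" unfolding num_tri_def num_up_def plane_sum_of_bool by simp_all
    \<comment> \<open>By \<open>count_identities\<close> for \<open>H\<close>, the gain in the
      triangles exceeds the possible loss in the inverted triangles by a third of
      \<open>5 * num_tri 2 + num_up 2\<close>, which is nonnegative.\<close>
    ultimately show ?thesis
      using count_identities[OF fH] unfolding Phi_def num_up_def[symmetric] by linarith
  qed
  show ?thesis by (rule that[OF F _ hf _ P]) (use nb in \<open>auto simp: F_def\<close>)
qed

section \<open>Descending through the layers\<close>

text \<open>Among the projected points above level \<open>c\<close>, the one with smallest first and
  then smallest second coordinate is not a left overhang. This yields a point that is smaller in
  this order and still at level at least \<open>c\<close>, hence above \<open>c\<close> if level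
  \<open>c\<close> is empty. The bound \<open>0 \<le> c\<close> keeps the chosen point away from the
  origin.\<close>

lemma layer_nonempty:
  assumes K: "finite K" "no_overhang3 K" and m: "(u, v, w) \<in> K" "c \<le> u + v + w" and c: "0 \<le> c"
  shows "\<exists>x y z. (x, y, z) \<in> K \<and> x + y + z = c"
proof (rule ccontr)
  assume no: "\<not> ?thesis"
  define P where "P = proj1 ` K"
  have nc: "a + b \<noteq> c" if "(a, b) \<in> P" for a b
    using no that unfolding P_def proj1_def by (force simp: algebra_simps)
  define B where "B = {p \<in> P. fst p + snd p > c}"
  have fB: "finite B" using K(1) unfolding B_def P_def by simp
  have "(u, v + w) \<in> P" unfolding P_def proj1_def using m(1) by force
  then have "(u, v + w) \<in> B" using nc[of u "v + w"] m(2) unfolding B_def by simp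
  then have "B \<noteq> {}" by blast
  then obtain p where p: "p \<in> B" "\<And>q. q \<in> B \<Longrightarrow> fst p \<le> fst q" using ex_argmin[OF fB, of fst] by blast
  obtain r where r: "r \<in> {q \<in> B. fst q = fst p}" "\<And>q. q \<in> {q \<in> B. fst q = fst p} \<Longrightarrow> snd r \<le> snd q"
    by (rule ex_argmin[of "{q \<in> B. fst q = fst p}" snd]) (use p(1) fB in \<open>simp, blast, blast\<close>)
  obtain a b where ab: "r = (a, b)" by force
  have rB: "(a, b) \<in> P" "a + b > c" "a = fst p" using r(1) unfolding B_def ab by auto
  then have "\<not> left_overhang P (a, b)"
    using K(2) unfolding no_overhang3_def overhang3_def overhang2_def P_def by auto
  then consider "(a, b - 1) \<in> P" | y where "y \<ge> b" "(a - 1, y) \<in> P"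
    using rB c unfolding left_overhang_def by auto
  then show False
  proof cases
    case 1
    then have "(a, b - 1) \<in> B" using nc[of a "b - 1"] rB(2) unfolding B_def by simp
    then show False using r(2)[of "(a, b - 1)"] ab rB(3) by simp
  next
    case 2
    then have "(a - 1, y) \<in> B" using nc[of "a - 1" y] rB(2) unfolding B_def by simp
    then show False using p(2)[of "(a - 1, y)"] rB(3) by simp
  qed
qed

section \<open>Nodes of the diagram, level by level\<close>

lemma node_values:
  "{a, b, c, d} \<in> {{Pos}, {Neg}, {Zero, Pos}, {Zero, Neg}} \<longleftrightarrow>
    \<not> (a = Zero \<and> b = Zero \<and> c = Zero \<and> d = Zero) \<and>
    (\<exists>s. \<forall>e\<in>{a, b, c, d}. e \<noteq> Zero \<longrightarrow> (e = Pos) = s)"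
  by (cases a; cases b; cases c; cases d; auto simp: ex_bool_eq)

definition layer :: "(pt3 \<Rightarrow> sgn) \<Rightarrow> int \<Rightarrow> (int \<times> int) set" where
  "layer D c = {(x, y). D (x, y, c - x - y) \<noteq> Zero}"

definition pos :: "(pt3 \<Rightarrow> sgn) \<Rightarrow> int \<Rightarrow> int \<Rightarrow> int \<Rightarrow> bool" where
  "pos D c x y \<longleftrightarrow> D (x, y, c - x - y) = Pos"

lemma support3_iff: "m \<in> support3 D \<longleftrightarrow> D m \<noteq> Zero"
  unfolding support3_def by (cases "D m") auto

lemma is_node3_iff:
  "is_node3 D (x, y, c + 1 - x - y) \<longleftrightarrow>
    node_at (pt_in (layer D (c + 1))) (pos D (c + 1)) (pt_in (layer D c)) (pos D c) x y"
proof -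
  have "D ` E3 (x, y, c + 1 - x - y) = {D (x, y, c + 1 - x - y), D (x - 1, y, c - (x - 1) - y),
      D (x, y - 1, c - x - (y - 1)), D (x, y, c - x - y)}"
    unfolding E3_def by (auto simp: algebra_simps)
  then show ?thesis
    unfolding is_node3_def node_at_def pt_in_def layer_def pos_def
    by (simp only: node_values) auto
qed

definition level_nodes :: "(pt3 \<Rightarrow> sgn) \<Rightarrow> int \<Rightarrow> pt3 set" where
  "level_nodes D c = {(x, y, z). is_node3 D (x, y, z) \<and> x + y + z = c}"

lemma card_level_nodes:
  "int (card (level_nodes D (c + 1)))
    = plane_sum (\<lambda>x y. of_bool (node_at (pt_in (layer D (c + 1))) (pos D (c + 1)) (pt_in (layer D c)) (pos D c) x y))"
proof -
  have "(x, y, z) \<in> level_nodes D (c + 1) \<longleftrightarrow> is_node3 D (x, y, c + 1 - x - y) \<and> z = c + 1 - x - y" for x y z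
  proof -
    have "x + y + z = c + 1 \<longleftrightarrow> z = c + 1 - x - y" by linarith
    then show ?thesis unfolding level_nodes_def by auto
  qed
  then have "level_nodes D (c + 1) = (\<lambda>(x, y). (x, y, c + 1 - x - y)) ` {(x, y). is_node3 D (x, y, c + 1 - x - y)}"
    by (auto simp: image_iff)
  then have "card (level_nodes D (c + 1)) = card {(x, y). is_node3 D (x, y, c + 1 - x - y)}"
    by (simp add: card_image inj_on_def case_prod_beta prod_eq_iff)
  then show ?thesis unfolding is_node3_iff plane_sum_of_bool by simp
qed

lemma node_at_cong:
  assumes "\<And>x y. S x y \<Longrightarrow> gS x y = hS x y" "\<And>x y. U x y \<Longrightarrow> gU x y = hU x y"
  shows "node_at S gS U gU x y = node_at S hS U hU x y"
  unfolding node_at_def by (simp add: assms cong: imp_cong)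

lemma finite_layer:
  assumes "finite (support3 D)" shows "finite (layer D c)"
proof -
  have "layer D c \<subseteq> (\<lambda>(x, y, z). (x, y)) ` support3 D"
    unfolding layer_def by (force simp: support3_iff)
  then show ?thesis using assms finite_subset by blast
qed

text \<open>Induction down from the top layer. The invariant keeps a set \<open>V\<close> around the
  current layer whose added points all have the same sign \<open>b\<close>; the sum covers the
  levels from \<open>k + 1\<close> down to \<open>k - int j + 1\<close>.\<close>

lemma layer_chain:
  fixes D :: "pt3 \<Rightarrow> sgn" and k :: int
  assumes finK: "finite (support3 D)"
    and top: "layer D (k + 1) = {}"
    and ne: "\<And>c. 0 \<le> c \<Longrightarrow> c \<le> k \<Longrightarrow> layer D c \<noteq> {}"
    and j: "int j \<le> k"
  shows "\<exists>V g b. finite V \<and> layer D (k - int j) \<subseteq> V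
    \<and> (\<forall>x y. (x, y) \<in> layer D (k - int j) \<longrightarrow> g x y = pos D (k - int j) x y)
    \<and> (\<forall>x y. (x, y) \<in> V - layer D (k - int j) \<longrightarrow> g x y = b)
    \<and> 2 * (\<Sum>i\<le>j. int (card (level_nodes D (k - int i + 1)))) \<ge> Phi (pt_in V) g + 4 * int j"
  using j
proof (induction j)
  case 0
  have "pt_in {} = (\<lambda>_ _. False)" by (intro ext) (simp add: pt_in_def)
  then have "Phi (pt_in (layer D k)) (pos D k) \<le> 2 * int (card (level_nodes D (k + 1)))"
    unfolding card_level_nodes top using Phi_le_nodes[OF fin_pred_pt_in[OF finite_layer[OF finK]]] by simp
  then show ?case using finite_layer[OF finK] by (intro exI[of _ "layer D k"] exI[of _ "pos D k"] exI[of _ True]) simp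
next
  case (Suc j)
  define c where "c = k - int (Suc j)"
  have c1: "k - int j = c + 1" unfolding c_def by simp
  from Suc obtain V g b where V: "finite V" "layer D (c + 1) \<subseteq> V"
    "\<And>x y. (x, y) \<in> layer D (c + 1) \<Longrightarrow> g x y = pos D (c + 1) x y"
    "\<And>x y. (x, y) \<in> V - layer D (c + 1) \<Longrightarrow> g x y = b"
    "2 * (\<Sum>i\<le>j. int (card (level_nodes D (k - int i + 1)))) \<ge> Phi (pt_in V) g + 4 * int j"
    unfolding c1 by force
  obtain F where F: "finite F" "V \<subseteq> F" "hole_free F" "\<And>p. p \<in> F - V \<Longrightarrow> nbr p \<subseteq> F" "Phi (pt_in F) g \<le> Phi (pt_in V) g"
    using fill_holes[OF V(1)] by metis
  \<comment> \<open>The added points are those whose three points above all lie in \<open>F\<close>.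
    They get the sign opposite to \<open>b\<close>, as \<open>step_count\<close> requires.\<close>
  define W where "W = layer D c \<union> {(x, y). (x, y) \<in> F \<and> (x + 1, y) \<in> F \<and> (x, y + 1) \<in> F}"
  define h where "h x y = (if (x, y) \<in> layer D c then pos D c x y else \<not> b)" for x y
  have fW: "finite W"
    using finite_layer[OF finK, of c] F(1) unfolding W_def by (auto elim: finite_subset[rotated])
  have "layer D (c + 1) \<noteq> {}" using ne[of "c + 1"] Suc.prems unfolding c_def by simp
  then have "F \<noteq> {}" using V(2) F(2) by blast
  note eul = hole_free_count[OF F(1) this F(3)]
  have "Phi (pt_in W) h - Phi (pt_in F) g + 4
      \<le> 2 * plane_sum (\<lambda>x y. of_bool (node_at (pt_in (layer D (c + 1))) g (pt_in (layer D c)) h x y))"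
  \<comment> \<open>The parameter of \<open>step_count\<close> is the sign of the newly added
    points.\<close>
  proof (rule step_count[where V = "pt_in V" and b = "\<not> b"])
    show "fin_pred (pt_in W)" "fin_pred (pt_in F)" using fW F(1) by (simp_all add: fin_pred_pt_in)
    show "num_tri (pt_in F) 1 - num_up (pt_in F) 2 \<ge> 3" by (rule eul)
    show "pt_in F (x + 1) y \<and> pt_in F (x - 1) y \<and> pt_in F x (y + 1) \<and> pt_in F x (y - 1)
        \<and> pt_in F (x + 1) (y - 1) \<and> pt_in F (x - 1) (y + 1)" if "pt_in F x y" "\<not> pt_in V x y" for x y
      using F(4)[of "(x, y)"] that unfolding pt_in_def nbr_def by simp
  qed (use V(2,4) F(2) in \<open>auto simp: pt_in_def W_def h_def\<close>)
  \<comment> \<open>Only signs on the layers themselves enter, and there \<open>g\<close> and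
    \<open>h\<close> agree with the diagram.\<close>
  also have "(\<lambda>x y. of_bool (node_at (pt_in (layer D (c + 1))) g (pt_in (layer D c)) h x y))
      = (\<lambda>x y. of_bool (node_at (pt_in (layer D (c + 1))) (pos D (c + 1)) (pt_in (layer D c)) (pos D c) x y) :: int)"
    by (intro ext arg_cong[of _ _ of_bool] node_at_cong) (simp_all add: pt_in_def V(3) h_def)
  also have "plane_sum \<dots> = int (card (level_nodes D (c + 1)))" by (rule card_level_nodes[symmetric])
  finally have "2 * (\<Sum>i\<le>Suc j. int (card (level_nodes D (k - int i + 1)))) \<ge> Phi (pt_in W) h + 4 * int (Suc j)"
    using V(5) F(5) by (simp add: c_def)
  moreover have "layer D c \<subseteq> W" unfolding W_def by blast
  moreover have "h x y = pos D c x y" if "(x, y) \<in> layer D c" for x y using that by (simp add: h_def)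
  moreover have "h x y = (\<not> b)" if "(x, y) \<in> W - layer D c" for x y using that by (simp add: h_def)
  ultimately show ?case unfolding c_def[symmetric] using fW by blast
qed

lemma finite_nodes:
  assumes "finite (support3 D)" shows "finite {a. is_node3 D a}"
proof (rule finite_subset)
  show "{a. is_node3 D a} \<subseteq> (\<Union>m\<in>support3 D. {a. m \<in> E3 a})"
  proof
    fix a assume "a \<in> {a. is_node3 D a}"
    then have "Pos \<in> D ` E3 a \<or> Neg \<in> D ` E3 a" unfolding is_node3_def by blast
    then obtain m where "m \<in> E3 a" "D m = Pos \<or> D m = Neg" by force
    then show "a \<in> (\<Union>m\<in>support3 D. {a. m \<in> E3 a})" unfolding support3_def by blast
  qed
  have "finite {a. m \<in> E3 a}" for m
  proof -
    obtain u v w where m: "m = (u, v, w)" by (cases m) auto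
    have "{a. m \<in> E3 a} \<subseteq> {(u, v, w), (u + 1, v, w), (u, v + 1, w), (u, v, w + 1)}"
      by (auto simp: E3_def m)
    then show ?thesis by (rule finite_subset) simp
  qed
  then show "finite (\<Union>m\<in>support3 D. {a. m \<in> E3 a})" using assms by blast
qed

theorem mainTheorem11:
  fixes D :: "pt3 \<Rightarrow> sgn" and d :: int
  assumes "newton_diagram3 D"
    and "size3 (support3 D) = d"
    and "no_overhang3 (support3 D)"
  shows "int (num_nodes3 D) \<ge> 2 * d + 2"
proof -
  define K where "K = support3 D"
  have K: "finite K" "K \<noteq> {}" "\<And>x y z. (x, y, z) \<in> K \<Longrightarrow> x \<ge> 0 \<and> y \<ge> 0 \<and> z \<ge> 0"
    using assms(1) unfolding newton_diagram3_def K_def by auto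
  define lev where "lev = (\<lambda>(x, y, z). x + y + z :: int)"
  define k where "k = Max (lev ` K)"
  obtain m where m: "m \<in> K" "lev m = k"
    using Max_in[of "lev ` K"] K unfolding k_def by fastforce
  have le_k: "x + y + z \<le> k" if "(x, y, z) \<in> K" for x y z
  proof -
    have "lev (x, y, z) \<le> k" unfolding k_def using K(1) that by (intro Max_ge) auto
    then show ?thesis by (simp add: lev_def)
  qed
  obtain u v w where uvw: "m = (u, v, w)" by (cases m) auto
  have lay: "\<exists>x y z. (x, y, z) \<in> K \<and> x + y + z = c" if "0 \<le> c" "c \<le> k" for c
    using layer_nonempty[OF K(1) assms(3)[folded K_def], of u v w c] m that uvw by (simp add: lev_def)
  have k0: "0 \<le> k" using m K(3) uvw by (auto simp: lev_def)
  \<comment> \<open>The only point of level 0 with nonnegative coordinates is the origin, so all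
    coordinate minima are 0 and the size is \<open>k + 1\<close>.\<close>
  have o: "(0, 0, 0) \<in> K"
  proof -
    obtain x y z where "(x, y, z) \<in> K" "x + y + z = 0" using lay[of 0] k0 by auto
    moreover from this have "x = 0 \<and> y = 0 \<and> z = 0" using K(3)[of x y z] by linarith
    ultimately show ?thesis by simp
  qed
  have "Min ((\<lambda>(x, y, z). x) ` K) = 0" "Min ((\<lambda>(x, y, z). y) ` K) = 0" "Min ((\<lambda>(x, y, z). z) ` K) = 0"
    by (rule Min_eqI; use K o in force)+
  then have d: "d = k + 1"
    using assms(2) unfolding size3_def K_def[symmetric] k_def lev_def by simp
  have ne: "layer D c \<noteq> {}" if c: "0 \<le> c" "c \<le> k" for c
  proof -
    obtain x y z where xyz: "(x, y, z) \<in> K" "x + y + z = c" using lay[OF c] by blast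
    then have "z = c - x - y" by linarith
    then show ?thesis using xyz(1) unfolding layer_def K_def support3_iff by auto
  qed
  have top: "layer D (k + 1) = {}"
    using le_k unfolding layer_def K_def support3_iff by force
  obtain V g where V: "finite V" "layer D 0 \<subseteq> V"
    "2 * (\<Sum>i\<le>nat k. int (card (level_nodes D (k - int i + 1)))) \<ge> Phi (pt_in V) g + 4 * k"
    using layer_chain[OF K(1)[unfolded K_def] top ne, of "nat k"] k0 by auto
  \<comment> \<open>The set around the bottom layer may have holes; filling them does not increase
    the potential and makes the bound 6 available.\<close>
  obtain F where F: "finite F" "V \<subseteq> F" "hole_free F" "Phi (pt_in F) g \<le> Phi (pt_in V) g"
    using fill_holes[OF V(1)] by metis
  have "F \<noteq> {}" using ne[of 0] k0 V(2) F(2) by blast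
  then have "Phi (pt_in V) g \<ge> 6" using hole_free_Phi[OF F(1) _ F(3), of g] F(4) by linarith
  with V(3) have S: "(\<Sum>i\<le>nat k. int (card (level_nodes D (k - int i + 1)))) \<ge> 3 + 2 * k" by linarith
  have zero: "D (x, y, z) = Zero" if "x < 0 \<or> y < 0 \<or> z < 0" for x y z
    using K(3)[of x y z] that unfolding K_def support3_iff by force
  have "D (0, 0, 0) \<noteq> Zero" using o unfolding K_def support3_iff .
  then have node0: "is_node3 D (0, 0, 0)"
    unfolding is_node3_def E3_def using zero[of "-1" 0 0] zero[of 0 "-1" 0] zero[of 0 0 "-1"]
    by (cases "D (0, 0, 0)") auto
  note finN = finite_nodes[OF K(1)[unfolded K_def]]
  let ?T = "\<lambda>i::nat. level_nodes D (k - int i + 1)"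
  have fT: "finite (?T i)" for i by (rule finite_subset[OF _ finN]) (auto simp: level_nodes_def)
  have "card (\<Union>i\<le>nat k. ?T i) = (\<Sum>i\<le>nat k. card (?T i))"
    by (rule card_UN_disjoint) (auto simp: fT, auto simp: level_nodes_def)
  \<comment> \<open>The sum covers the levels 1 to \<open>k + 1\<close>, so the node at the origin
    is an additional one. The total is at least \<open>3 + 2 * k + 1\<close>, which is
    \<open>2 * d + 2\<close>.\<close>
  moreover have "(0, 0, 0) \<notin> (\<Union>i\<le>nat k. ?T i)" using k0 by (auto simp: level_nodes_def)
  ultimately have "card (insert (0, 0, 0) (\<Union>i\<le>nat k. ?T i)) = Suc (\<Sum>i\<le>nat k. card (?T i))"
    using fT by simp
  moreover have "insert (0, 0, 0) (\<Union>i\<le>nat k. ?T i) \<subseteq> {a. is_node3 D a}"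
    using node0 by (auto simp: level_nodes_def)
  ultimately have "Suc (\<Sum>i\<le>nat k. card (?T i)) \<le> num_nodes3 D"
    unfolding num_nodes3_def by (metis card_mono[OF finN])
  then have "int (Suc (\<Sum>i\<le>nat k. card (?T i))) \<le> int (num_nodes3 D)" by (rule of_nat_mono)
  then show ?thesis using S d by simp
qed

end
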